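(* Let $t>0$, $\widehat\alpha>0$, and $q_N=\widehat\alpha N/t$ for $N\ge1$. Let $(m_N)$ be a sequence of positive integers with $m_N/N\to\vartheta>0$ as $N\to\infty$, and assume $$0<\frac{\widehat\alpha}{\vartheta}<\alpha_c=\frac{3\sqrt3}2 .$$ Then $$\lim_{N\to\infty}\left(\mathcal E_{m_N}^{\rm rat}(t,q_N)\right)^{1/m_N}=H_e\!\left(\frac{\widehat\alpha}{\vartheta}\right).$$ After the Möbius transformation the same root factor is inherited by every subexponentially quasi-best polynomial process: with $\lambda_N=tq_N$, if polynomials $p_N$ of degree at most $m_N$ satisfy $$E_{m_N}(\lambda_N)\le\|F_{\lambda_N}-p_N\|_\infty\le C_NE_{m_N}(\lambda_N),\qquad C_N\ge1,\quad\log C_N=o(m_N),$$ then $\lim_{N\to\infty}\|F_{\lambda_N}-p_N\|_\infty^{1/m_N}=H_e(\widehat\alpha/\vartheta)$.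
   Context: For $q>0$ and an integer $m\ge0$, $\mathcal R_m(q)=\left\{\frac{P_m(z)}{(q-z)^m}:\ P_m\text{ a polynomial},\ \deg P_m\le m\right\}$, and for $t>0$, $$\mathcal E_m^{\rm rat}(t,q)=\inf_{r\in\mathcal R_m(q)}\ \sup_{z\le0}|e^{tz}-r(z)| .$$ The Möbius transformation $x=\frac{q+z}{q-z}$ turns $e^{tz}$ on $(-\infty,0]$ into $F_\lambda(x)=\exp\!\left(-\lambda\frac{1-x}{1+x}\right)$ on $(-1,1]$ with $\lambda=tq$; put $F_\lambda(-1)=0$. Here $\|g\|_\infty=\sup_{[-1,1]}|g|$ and $E_m(\lambda)=\inf\|F_\lambda-p\|_\infty$ over polynomials $p$ of degree at most $m$. For $0<\alpha<\alpha_c$, $\zeta_\alpha$ is the unique root of $\alpha(\zeta^3-\zeta)+1=0$ in the open first quadrant, and $H_e(\alpha)=\left|\frac{\zeta_\alpha-1}{\zeta_\alpha+1}\right|\exp\bigl(\alpha\operatorname{Re}(\zeta_\alpha^2)\bigr)$. *)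

theory Defs
  imports Complex_Main "HOL-Computational_Algebra.Polynomial" "HOL-Library.Landau_Symbols"
begin

text \<open>
  Polynomials have complex coefficients throughout. All suprema below are taken over bounded
  nonempty sets of reals and all infima over nonempty sets of nonnegative reals, so the real-valued
  \<open>SUP\<close> and \<open>INF\<close> are the usual ones. For \<open>rat_error\<close> this uses \<open>q > 0\<close> and
  \<open>degree P \<le> m\<close>; for \<open>cheb_error\<close> it uses \<open>lam \<ge> 0\<close>.
\<close>

definition rat_class :: "nat \<Rightarrow> real \<Rightarrow> (complex \<Rightarrow> complex) set" where
  "rat_class m q = {\<lambda>z. poly P z / (of_real q - z) ^ m | P :: complex poly. degree P \<le> m}"

definition rat_error :: "nat \<Rightarrow> real \<Rightarrow> real \<Rightarrow> real" where
  "rat_error m t q =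
     (INF r \<in> rat_class m q. SUP z \<in> {..0::real}. cmod (of_real (exp (t * z)) - r (of_real z)))"

definition F :: "real \<Rightarrow> real \<Rightarrow> real" where
  "F lam x = (if x = -1 then 0 else exp (- lam * ((1 - x) / (1 + x))))"

definition sup_norm :: "(real \<Rightarrow> complex) \<Rightarrow> real" where
  "sup_norm g = (SUP x \<in> {-1..1}. cmod (g x))"

definition approx_error :: "real \<Rightarrow> complex poly \<Rightarrow> real" where
  "approx_error lam p = sup_norm (\<lambda>x. of_real (F lam x) - poly p (of_real x))"

definition cheb_error :: "nat \<Rightarrow> real \<Rightarrow> real" where
  "cheb_error m lam = (INF p \<in> {p :: complex poly. degree p \<le> m}. approx_error lam p)"

definition alpha_c :: real where
  "alpha_c = 3 * sqrt 3 / 2"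

text \<open>The root below exists and is unique when \<open>0 < \<alpha> < alpha_c\<close>; outside that range
  the description operator carries no information.\<close>

definition zeta :: "real \<Rightarrow> complex" where
  "zeta \<alpha> = (THE \<zeta>. Re \<zeta> > 0 \<and> Im \<zeta> > 0 \<and> of_real \<alpha> * (\<zeta> ^ 3 - \<zeta>) + 1 = 0)"

definition H_e :: "real \<Rightarrow> real" where
  "H_e \<alpha> = cmod ((zeta \<alpha> - 1) / (zeta \<alpha> + 1)) * exp (\<alpha> * Re ((zeta \<alpha>) ^ 2))"

end

theory Submission
  imports Defs "HOL-Complex_Analysis.Complex_Analysis" "HOL-Probability.Sinc_Integral"
begin

text \<open>
  Put \<open>\<lambda> = t q\<close> and \<open>z = q s\<close>. With \<open>s = \<zeta>\<^sup>2\<close> the negative half-axis becomes the imaginary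
  \<open>\<zeta>\<close>-axis, the target becomes the entire function \<open>exp (\<lambda> \<zeta>\<^sup>2)\<close>, and the Cayley transform
  \<open>b(\<zeta>) = (1 - \<zeta>) / (1 + \<zeta>)\<close> is unimodular on that axis and of modulus below 1 to the right of it.
  Both rates are governed by the integrand \<open>exp (\<lambda> \<zeta>\<^sup>2) b(\<zeta>) ^ m\<close>, that is, for \<open>\<lambda> \<approx> \<alpha> m\<close>, by the
  phase \<open>\<phi>(\<zeta>) = \<alpha> \<zeta>\<^sup>2 + log b(\<zeta>)\<close>, whose critical points are the roots of
  \<open>\<alpha> (\<zeta>\<^sup>3 - \<zeta>) + 1 = 0\<close>. The claimed limit is \<open>exp (Re \<phi>(\<zeta>\<^sub>\<alpha>))\<close>.

  The argument rests on vertical lines. On \<open>Re \<zeta> = x\<close> the function \<open>Re \<phi>\<close> is concave in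
  \<open>(Im \<zeta>)\<^sup>2\<close>. It is bounded by an explicit \<open>ridge \<alpha> x\<close>, which is its maximum if that is attained off the
  real axis, as happens for \<open>x\<close> near \<open>Re \<zeta>\<^sub>\<alpha>\<close>. As a function of \<open>x\<close> the ridge has
  derivative of the sign of \<open>x - a\<close> with \<open>a = Re \<zeta>\<^sub>\<alpha>\<close>: among all vertical lines, the one through the
  saddle has the smallest maximum, and \<open>H_e \<alpha> = exp (ridge \<alpha> a)\<close>.

  Upper bound (\<open>truncated_chebyshev_approximation\<close>): Cauchy's formula in the strip
  \<open>\<bar>Re \<zeta>\<bar> < a\<close> writes \<open>exp (\<lambda> \<zeta>\<^sub>0\<^sup>2)\<close> as an integral over \<open>Re \<zeta> = a\<close>. Expanding the kernel geometrically
  in \<open>b(\<zeta>) / b(\<zeta>\<^sub>0)\<close> and truncating after \<open>m\<close> terms leaves a polynomial of degree at most \<open>m\<close> in \<open>x\<close>, with a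
  remainder controlled by the maximum of the integrand over the line.

  Lower bound (\<open>rational_error_duality\<close>): a rational function of the class, multiplied by
  \<open>b ^ m\<close>, is bounded and analytic in the right half-plane, so integrating the error against
  \<open>b ^ m h\<close> along the imaginary axis with \<open>h\<close> bounded and analytic sees only \<open>exp (\<lambda> \<zeta>\<^sup>2)\<close>. The two
  conjugate saddles interfere, so a plain saddle-point evaluation could nearly vanish for some \<open>m\<close>.
  Interference and asymptotic expansion are both avoided by
  \<open>h(\<zeta>) = (1 - exp (- n (\<zeta> - w))) / (\<zeta> - w)\<close>. The first summand is estimated on the
  line \<open>Re \<zeta> = a\<close> to the left of \<open>w\<close>, the second on a line to the right of \<open>w\<close>, where the exponential gains.
  The second shift crosses the pole \<open>w\<close>, and its residue is exactly \<open>exp (\<lambda> w\<^sup>2) b(w) ^ m\<close> up to a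
  fixed factor. Because the ridge is strictly increasing to the right of \<open>a\<close>, with derivative tending to
  0 at \<open>a\<close>, a point \<open>w\<close> on the ridge slightly to the right of the saddle makes the residue
  dominate both line integrals already for \<open>n = \<epsilon> m\<close> with small \<open>\<epsilon>\<close> (\<open>ridge_rises_slowly\<close>). The
  price is the factor \<open>sup \<bar>h\<bar> = exp (O(\<epsilon> m))\<close>, which disappears as \<open>\<epsilon> \<rightarrow> 0\<close>.

  Finally the rational error is at most the polynomial one by the Moebius substitution, so both
  problems, and every process within a subexponential factor of the optimum, share the root limit.
\<close>

section \<open>The ridge of the phase over vertical lines\<close>

definition cay :: "complex \<Rightarrow> complex" where
  "cay z = (1 - z) / (1 + z)"

text \<open>
  If \<open>z\<close> is a point of \<open>Re z = x\<close> off the real axis at which \<open>\<bar>exp (\<alpha> z\<^sup>2) b(z)\<bar>\<close> is maximal along this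
  line, then \<open>height \<alpha> x\<close> is \<open>(\<bar>1 - z\<bar>\<^sup>2 + \<bar>1 + z\<bar>\<^sup>2) / 2 = 1 + x\<^sup>2 + (Im z)\<^sup>2\<close>. Hence \<open>\<bar>1 \<mp> z\<bar>\<^sup>2 = height \<alpha> x \<mp> 2 x\<close>,
  and the critical-point equation reads \<open>\<bar>1 - z\<^sup>2\<bar>\<^sup>2 = 2 x / \<alpha>\<close>. The logarithm of the maximum is then
  \<open>ridge \<alpha> x\<close>.
\<close>

definition height :: "real \<Rightarrow> real \<Rightarrow> real" where
  "height \<alpha> x = sqrt (2 * x / \<alpha> + 4 * x\<^sup>2)"

definition ridge :: "real \<Rightarrow> real \<Rightarrow> real" where
  "ridge \<alpha> x = \<alpha> * (2 * x\<^sup>2 + 1 - height \<alpha> x)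
      + ln ((height \<alpha> x - 2 * x) / (height \<alpha> x + 2 * x)) / 2"

lemma height_facts:
  assumes "\<alpha> > 0" "x > 0"
  shows "height \<alpha> x > 2 * x" "(height \<alpha> x)\<^sup>2 = 2 * x / \<alpha> + 4 * x\<^sup>2"
    "(height \<alpha> x - 2 * x) * (height \<alpha> x + 2 * x) = 2 * x / \<alpha>"
proof -
  show sq: "(height \<alpha> x)\<^sup>2 = 2 * x / \<alpha> + 4 * x\<^sup>2"
    unfolding height_def using assms by (subst real_sqrt_pow2) auto
  show "height \<alpha> x > 2 * x"
    unfolding height_def using assms by (intro real_less_rsqrt) (simp add: power_mult_distrib)
  show "(height \<alpha> x - 2 * x) * (height \<alpha> x + 2 * x) = 2 * x / \<alpha>"
    using sq by (simp add: algebra_simps power2_eq_square)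
qed

lemma norm_cay_sq:
  "(norm (cay z))\<^sup>2 = ((1 - Re z)\<^sup>2 + (Im z)\<^sup>2) / ((1 + Re z)\<^sup>2 + (Im z)\<^sup>2)"
  by (simp add: cay_def norm_divide power_divide cmod_power2 power2_commute)

lemma exp_ridge_sq:
  assumes "\<alpha> > 0" "x > 0"
  shows "(exp (ridge \<alpha> x))\<^sup>2 = exp (2 * \<alpha> * (2 * x\<^sup>2 + 1 - height \<alpha> x))
           * ((height \<alpha> x - 2 * x) / (height \<alpha> x + 2 * x))"
proof -
  have "(exp (ridge \<alpha> x))\<^sup>2 = exp (2 * ridge \<alpha> x)"
    by (simp add: power2_eq_square flip: exp_add)
  also have "2 * ridge \<alpha> x = 2 * \<alpha> * (2 * x\<^sup>2 + 1 - height \<alpha> x)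
      + ln ((height \<alpha> x - 2 * x) / (height \<alpha> x + 2 * x))"
    by (simp add: ridge_def)
  finally show ?thesis
    using height_facts[OF assms] assms by (simp add: exp_add)
qed

lemma norm_exp_sq: "norm (exp (of_real \<alpha> * z\<^sup>2)) = exp (\<alpha> * ((Re z)\<^sup>2 - (Im z)\<^sup>2))"
  by (simp add: power2_eq_square)

text \<open>
  With \<open>Y = (Im z)\<^sup>2\<close> at distance \<open>d\<close> from its critical value, \<open>log \<bar>b\<bar>\<close> is compared with its
  tangent at the critical value: the inequality \<open>1 + u \<le> exp u\<close> at \<open>u = 2 \<alpha> d\<close> suffices, because the
  discrepancy is the square \<open>2 \<alpha> d\<^sup>2\<close> up to a positive factor.
\<close>

lemma line_bound:
  assumes "\<alpha> > 0" "Re z > 0"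
  shows "norm (exp (of_real \<alpha> * z\<^sup>2)) * norm (cay z) \<le> exp (ridge \<alpha> (Re z))"
proof -
  define x Y S where "x = Re z" and "Y = (Im z)\<^sup>2" and "S = height \<alpha> (Re z)"
  define d where "d = Y - (S - 1 - x\<^sup>2)"
  define p q where "p = S - 2 * x" and "q = S + 2 * x"
  have x: "x > 0" and S: "S > 2 * x" "p * q = 2 * x / \<alpha>"
    using height_facts[of \<alpha> x] assms by (auto simp: x_def S_def p_def q_def)
  have pq: "p > 0" "q > 0" using x S by (auto simp: p_def q_def)
  have num: "(1 - x)\<^sup>2 + Y = p + d" and den: "(1 + x)\<^sup>2 + Y = q + d"
    by (auto simp: d_def p_def q_def power2_eq_square algebra_simps)
  have q': "q + d > 0"
    using x unfolding den[symmetric] Y_def by (simp add: add_pos_nonneg)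
  have "(p + d) * q = p * (q + d) + 4 * x * d"
    by (simp add: p_def q_def algebra_simps)
  \<comment> \<open>the critical-point equation, which makes the terms linear in \<open>d\<close> cancel\<close>
  also have "4 * x = 2 * \<alpha> * (p * q)" using S assms by simp
  also have "p * (q + d) + 2 * \<alpha> * (p * q) * d
      = p * (q + d) * (1 + 2 * \<alpha> * d) - 2 * \<alpha> * d\<^sup>2 * p"
    by (simp add: algebra_simps power2_eq_square)
  also have "\<dots> \<le> p * (q + d) * (1 + 2 * \<alpha> * d)"
    using assms pq by simp
  also have "\<dots> \<le> p * (q + d) * exp (2 * \<alpha> * d)"
    using pq q' by (intro mult_left_mono exp_ge_add_one_self) auto
  finally have "(p + d) / (q + d) \<le> exp (2 * \<alpha> * d) * (p / q)"
    using pq q' by (simp add: field_simps)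
  then have "exp (2 * \<alpha> * (x\<^sup>2 - Y)) * ((p + d) / (q + d))
      \<le> exp (2 * \<alpha> * (x\<^sup>2 - Y)) * (exp (2 * \<alpha> * d) * (p / q))"
    by (intro mult_left_mono) auto
  also have "\<dots> = exp (2 * \<alpha> * (2 * x\<^sup>2 + 1 - S)) * (p / q)"
  proof -
    have "exp (2 * \<alpha> * (x\<^sup>2 - Y)) * exp (2 * \<alpha> * d) = exp (2 * \<alpha> * (2 * x\<^sup>2 + 1 - S))"
      by (simp add: d_def algebra_simps flip: exp_add)
    then show ?thesis by (simp only: mult.assoc[symmetric])
  qed
  also have "\<dots> = (exp (ridge \<alpha> (Re z)))\<^sup>2"
    unfolding exp_ridge_sq[OF assms] p_def q_def S_def x_def ..
  finally have "exp (2 * \<alpha> * (x\<^sup>2 - Y)) * ((p + d) / (q + d)) \<le> (exp (ridge \<alpha> (Re z)))\<^sup>2" .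
  moreover have "exp (2 * \<alpha> * (x\<^sup>2 - Y)) * ((p + d) / (q + d)) = (norm (exp (of_real \<alpha> * z\<^sup>2)) * norm (cay z))\<^sup>2"
    unfolding power_mult_distrib norm_cay_sq norm_exp_sq num[symmetric] den[symmetric]
    by (simp only: x_def Y_def exp_double[symmetric] mult.assoc)
  ultimately have "(norm (exp (of_real \<alpha> * z\<^sup>2)) * norm (cay z))\<^sup>2 \<le> (exp (ridge \<alpha> (Re z)))\<^sup>2"
    by (simp only:)
  then show ?thesis by (rule power2_le_imp_le) simp
qed

lemma line_bound_attained:
  assumes "\<alpha> > 0" "x > 0" "height \<alpha> x \<ge> 1 + x\<^sup>2"
  defines "z \<equiv> Complex x (sqrt (height \<alpha> x - 1 - x\<^sup>2))"
  shows "norm (exp (of_real \<alpha> * z\<^sup>2)) * norm (cay z) = exp (ridge \<alpha> x)"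
proof -
  have z: "Re z = x" "(Im z)\<^sup>2 = height \<alpha> x - 1 - x\<^sup>2"
    using assms by (auto simp: z_def)
  have a: "(norm (cay z))\<^sup>2 = (height \<alpha> x - 2 * x) / (height \<alpha> x + 2 * x)"
    unfolding norm_cay_sq z by (simp add: power2_eq_square algebra_simps)
  have b: "(norm (exp (of_real \<alpha> * z\<^sup>2)))\<^sup>2 = exp (2 * \<alpha> * (2 * x\<^sup>2 + 1 - height \<alpha> x))"
    unfolding norm_exp_sq z by (simp add: power2_eq_square algebra_simps flip: exp_add)
  have "(norm (exp (of_real \<alpha> * z\<^sup>2)) * norm (cay z))\<^sup>2 = (exp (ridge \<alpha> x))\<^sup>2"
    unfolding power_mult_distrib a b exp_ridge_sq[OF assms(1,2)] ..
  then show ?thesis by (rule power2_eq_imp_eq) auto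
qed

text \<open>
  The closed form is simple because the derivative in the imaginary direction vanishes on the ridge.
  The sign of \<open>4 x\<^sup>2 - height \<alpha> x\<close> is that of \<open>8 x\<^sup>3 - 2 x - 1 / \<alpha>\<close>, so the ridge is stationary
  precisely over the real part of the saddle.
\<close>

lemma ridge_deriv:
  assumes "\<alpha> > 0" "x > 0"
  shows "(ridge \<alpha> has_real_derivative (\<alpha> / x * (4 * x\<^sup>2 - height \<alpha> x))) (at x)"
proof -
  define S where "S = height \<alpha> x"
  define S' where "S' = (1 / \<alpha> + 4 * x) / S"
  have S: "S > 2 * x" "S > 0" "(S - 2 * x) * (S + 2 * x) = 2 * x / \<alpha>" "S\<^sup>2 = 2 * x / \<alpha> + 4 * x\<^sup>2"
    using height_facts[OF assms] assms by (auto simp: S_def)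
  have pos: "2 * x / \<alpha> + 4 * x\<^sup>2 > 0" using assms by (simp add: add_pos_pos)
  have dS: "(height \<alpha> has_real_derivative S') (at x)"
    unfolding height_def[abs_def] S'_def S_def using assms pos
    by (auto intro!: derivative_eq_intros simp: field_simps)
  have d: "(ridge \<alpha> has_real_derivative (\<alpha> * (4 * x - S')
      + ((S' - 2) / (S - 2 * x) - (S' + 2) / (S + 2 * x)) / 2)) (at x)"
  proof -
    have quot: "((u * q - p * v) / (q * q)) / (p / q) = u / p - v / q" if "p > 0" "q > 0" for u v p q :: real
      using that by (simp add: field_simps)
    have "((\<lambda>x. (height \<alpha> x - 2 * x) / (height \<alpha> x + 2 * x)) has_real_derivative
        ((S' - 2) * (S + 2 * x) - (S - 2 * x) * (S' + 2)) / ((S + 2 * x) * (S + 2 * x))) (at x)"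
      using S(1,2) assms unfolding S_def
      by (intro DERIV_divide) (auto intro!: derivative_eq_intros dS)
    from DERIV_chain2[OF DERIV_ln_divide this]
    have "((\<lambda>x. ln ((height \<alpha> x - 2 * x) / (height \<alpha> x + 2 * x))) has_real_derivative
        ((S' - 2) / (S - 2 * x) - (S' + 2) / (S + 2 * x))) (at x)"
      using S(1,2) assms quot[of "S - 2 * x" "S + 2 * x" "S' - 2" "S' + 2"]
      by (simp add: S_def[symmetric] mult.commute[of "S + 2 * x" "S - 2 * x"])
    then have "((\<lambda>x. ln ((height \<alpha> x - 2 * x) / (height \<alpha> x + 2 * x)) / 2) has_real_derivative
        ((S' - 2) / (S - 2 * x) - (S' + 2) / (S + 2 * x)) / 2) (at x)"
      by (rule DERIV_cdivide)
    moreover have "((\<lambda>x. \<alpha> * (2 * x\<^sup>2 + 1 - height \<alpha> x)) has_real_derivative \<alpha> * (4 * x - S')) (at x)"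
      by (auto intro!: derivative_eq_intros dS)
    ultimately show ?thesis
      unfolding ridge_def[abs_def] by (intro DERIV_add)
  qed
  have "((S' - 2) / (S - 2 * x) - (S' + 2) / (S + 2 * x))
      = ((S' - 2) * (S + 2 * x) - (S' + 2) * (S - 2 * x)) / ((S - 2 * x) * (S + 2 * x))"
    using S assms by (subst diff_frac_eq) auto
  also have "\<dots> = (4 * x * S' - 4 * S) / (2 * x / \<alpha>)"
    unfolding S(3) by (simp add: algebra_simps)
  also have "\<dots> = 2 * \<alpha> * S' - 2 * \<alpha> * S / x"
    using assms by (simp add: field_simps)
  finally have "\<alpha> * (4 * x - S') + ((S' - 2) / (S - 2 * x) - (S' + 2) / (S + 2 * x)) / 2
     = \<alpha> / x * (4 * x\<^sup>2 - S)"
    using assms by (simp add: field_simps power2_eq_square)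
  then show ?thesis using d by (simp add: S_def)
qed

text \<open>
  Eliminating the imaginary part \<open>y\<^sup>2 = 3 a\<^sup>2 - 1\<close> from \<open>\<alpha> (\<zeta>\<^sup>3 - \<zeta>) + 1 = 0\<close> leaves
  \<open>8 a\<^sup>3 - 2 a = 1 / \<alpha>\<close> for the real part. At \<open>a = 1 / sqrt 3\<close>, where \<open>y = 0\<close>, the cubic equals
  \<open>1 / alpha_c\<close>, which is how the critical value enters.
\<close>

lemma critical_abscissa:
  assumes "0 < \<alpha>" "\<alpha> < alpha_c"
  obtains a where "a > 0" "3 * a\<^sup>2 > 1" "8 * a ^ 3 - 2 * a = 1 / \<alpha>"
proof -
  define g where "g = (\<lambda>a::real. 8 * a ^ 3 - 2 * a)"
  define u where "u = 1 / sqrt (3::real)"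
  define v where "v = 1 + 1 / \<alpha>"
  have u: "u > 0" "3 * u\<^sup>2 = 1" by (auto simp: u_def power_divide)
  have "g u = 2 * u * (4 * u\<^sup>2 - 1)" by (simp add: g_def power2_eq_square power3_eq_cube algebra_simps)
  also have "4 * u\<^sup>2 - 1 = 1 / 3" using u by simp
  finally have gu: "g u = 1 / alpha_c"
    by (simp add: u_def alpha_c_def field_simps)
  have "1 / alpha_c < 1 / \<alpha>" using assms by (intro divide_strict_left_mono) (auto simp: alpha_c_def)
  then have lu: "g u < 1 / \<alpha>" using gu by simp
  have v1: "v \<ge> 1" using assms by (simp add: v_def)
  have "g v = v * (8 * v\<^sup>2 - 2)" by (simp add: g_def power2_eq_square power3_eq_cube algebra_simps)
  also have "v * (8 * v\<^sup>2 - 2) \<ge> v * 1"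
  proof (intro mult_left_mono)
    show "1 \<le> 8 * v\<^sup>2 - 2" using one_le_power[OF v1, of 2] by linarith
  qed (use v1 in simp)
  finally have gv: "g v \<ge> 1 / \<alpha>" by (simp add: v_def)
  have "u \<le> 1" by (simp add: u_def)
  then have "u \<le> v" using v1 by simp
  moreover have "continuous_on {u..v} g" unfolding g_def by (intro continuous_intros)
  ultimately obtain a where a: "u \<le> a" "a \<le> v" "g a = 1 / \<alpha>"
    using IVT'[of g u "1 / \<alpha>" v] lu gv by auto
  have "a \<noteq> u" using a lu by auto
  then have "u < a" using a by simp
  then have "a\<^sup>2 > u\<^sup>2" using u by (intro power_strict_mono) auto
  then show ?thesis using that[of a] a u \<open>u < a\<close> by (auto simp: g_def)
qed

lemma cubic_strict_mono:
  fixes a x :: real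
  assumes "a > 0" "3 * a\<^sup>2 > 1" "a < x"
  shows "8 * a ^ 3 - 2 * a < 8 * x ^ 3 - 2 * x"
proof -
  have "x\<^sup>2 > a\<^sup>2" using assms by (intro power_strict_mono) auto
  moreover have "x * a > 0" using assms by simp
  ultimately have "8 * (x\<^sup>2 + x * a + a\<^sup>2) - 2 > 0" using assms(2) by (simp only: distrib_left)
  then have "(x - a) * (8 * (x\<^sup>2 + x * a + a\<^sup>2) - 2) > 0" using assms by simp
  then show ?thesis by (simp add: algebra_simps power2_eq_square power3_eq_cube)
qed

lemma zeta_eq:
  assumes "\<alpha> > 0" "a > 0" "3 * a\<^sup>2 > 1" "8 * a ^ 3 - 2 * a = 1 / \<alpha>"
  shows "zeta \<alpha> = Complex a (sqrt (3 * a\<^sup>2 - 1))"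
  unfolding zeta_def
proof (rule the_equality)
  let ?z = "Complex a (sqrt (3 * a\<^sup>2 - 1))"
  have im: "(Im ?z)\<^sup>2 = 3 * a\<^sup>2 - 1" using assms by simp
  have eq: "\<alpha> * (8 * a ^ 3 - 2 * a) = 1" using assms by simp
  have *: "of_real \<alpha> * (z ^ 3 - z) + 1 = 0 \<longleftrightarrow>
     \<alpha> * (x ^ 3 - 3 * x * y\<^sup>2 - x) + 1 = 0 \<and> \<alpha> * (3 * x\<^sup>2 * y - y ^ 3 - y) = 0"
     if "z = Complex x y" for z x y
    using that by (simp add: complex_eq_iff power2_eq_square power3_eq_cube algebra_simps)
  have "\<alpha> * (a ^ 3 - 3 * a * (Im ?z)\<^sup>2 - a) + 1 = 0"
    unfolding im using eq by (simp add: algebra_simps power2_eq_square power3_eq_cube)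
  moreover have "3 * a\<^sup>2 * Im ?z - (Im ?z) ^ 3 - Im ?z = Im ?z * (3 * a\<^sup>2 - 1 - (Im ?z)\<^sup>2)"
    by (simp add: algebra_simps power2_eq_square power3_eq_cube)
  then have "\<alpha> * (3 * a\<^sup>2 * Im ?z - (Im ?z) ^ 3 - Im ?z) = 0" unfolding im by simp
  ultimately have "of_real \<alpha> * (?z ^ 3 - ?z) + 1 = 0"
    by (subst *[of _ a "Im ?z"]) auto
  then show "Re ?z > 0 \<and> Im ?z > 0 \<and> of_real \<alpha> * (?z ^ 3 - ?z) + 1 = 0"
    using assms by auto
next
  fix z :: complex
  assume z: "Re z > 0 \<and> Im z > 0 \<and> of_real \<alpha> * (z ^ 3 - z) + 1 = 0"
  define x y where "x = Re z" and "y = Im z"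
  have zz: "z = Complex x y" by (simp add: x_def y_def)
  have xy: "x > 0" "y > 0" using z by (auto simp: x_def y_def)
  have "\<alpha> * (x ^ 3 - 3 * x * y\<^sup>2 - x) + 1 = 0" and "\<alpha> * (3 * x\<^sup>2 * y - y ^ 3 - y) = 0"
    using z zz by (simp_all add: complex_eq_iff power2_eq_square power3_eq_cube algebra_simps)
  moreover have "3 * x\<^sup>2 * y - y ^ 3 - y = y * (3 * x\<^sup>2 - 1 - y\<^sup>2)"
    by (simp add: algebra_simps power2_eq_square power3_eq_cube)
  ultimately have y2: "y\<^sup>2 = 3 * x\<^sup>2 - 1" and re: "\<alpha> * (x ^ 3 - 3 * x * y\<^sup>2 - x) = - 1"
    using assms xy by auto
  have x3: "3 * x\<^sup>2 > 1" using y2 xy zero_less_power[of y 2] by linarith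
  have "x ^ 3 - 3 * x * y\<^sup>2 - x = - (8 * x ^ 3 - 2 * x)"
    unfolding y2 by (simp add: algebra_simps power2_eq_square power3_eq_cube)
  then have "\<alpha> * (8 * x ^ 3 - 2 * x) = 1" using re by (simp only: mult_minus_right)
  then have "8 * x ^ 3 - 2 * x = 1 / \<alpha>" using assms(1) by (simp add: eq_divide_eq mult.commute)
  then have "x = a"
    using cubic_strict_mono[of a x] cubic_strict_mono[of x a] assms xy x3
    by (cases x a rule: linorder_cases) auto
  moreover have "y = sqrt (3 * x\<^sup>2 - 1)" using y2 xy by (metis less_le real_sqrt_unique)
  ultimately show "z = Complex a (sqrt (3 * a\<^sup>2 - 1))" using zz by simp
qed

lemma height_critical:
  assumes "\<alpha> > 0" "a > 0" "8 * a ^ 3 - 2 * a = 1 / \<alpha>"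
  shows "height \<alpha> a = 4 * a\<^sup>2"
proof -
  have "2 * a / \<alpha> + 4 * a\<^sup>2 = 2 * a * (1 / \<alpha>) + 4 * a\<^sup>2" by simp
  also have "\<dots> = (4 * a\<^sup>2)\<^sup>2"
    unfolding assms(3)[symmetric] by (simp add: algebra_simps power2_eq_square power3_eq_cube)
  finally have "height \<alpha> a = sqrt ((4 * a\<^sup>2)\<^sup>2)" by (simp only: height_def)
  then show ?thesis by (simp only: real_sqrt_abs) simp
qed

text \<open>
  The saddle is the maximum of its own vertical line: at the critical abscissa the maximum
  is attained at \<open>(Im z)\<^sup>2 = height \<alpha> a - 1 - a\<^sup>2 = 3 a\<^sup>2 - 1\<close>.
\<close>

lemma H_e_eq_ridge:
  assumes "\<alpha> > 0" "a > 0" "3 * a\<^sup>2 > 1" "8 * a ^ 3 - 2 * a = 1 / \<alpha>"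
  shows "H_e \<alpha> = exp (ridge \<alpha> a)"
proof -
  have h: "height \<alpha> a = 4 * a\<^sup>2" using height_critical assms by simp
  have z: "zeta \<alpha> = Complex a (sqrt (height \<alpha> a - 1 - a\<^sup>2))"
    unfolding zeta_eq[OF assms] h by simp
  have "norm (cay (zeta \<alpha>)) = cmod ((zeta \<alpha> - 1) / (zeta \<alpha> + 1))"
    by (simp add: cay_def norm_divide norm_minus_commute add.commute)
  moreover have "norm (exp (of_real \<alpha> * (zeta \<alpha>)\<^sup>2)) = exp (\<alpha> * Re ((zeta \<alpha>)\<^sup>2))" by simp
  ultimately have "H_e \<alpha> = norm (exp (of_real \<alpha> * (zeta \<alpha>)\<^sup>2)) * norm (cay (zeta \<alpha>))"
    by (simp add: H_e_def)
  also have "\<dots> = exp (ridge \<alpha> a)"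
    unfolding z using line_bound_attained[of \<alpha> a] assms h by simp
  finally show ?thesis .
qed

text \<open>
  The geometric input of the lower bound. The pole of the test function will sit on the ridge over
  \<open>x0\<close>: strictly higher than the line over \<open>a\<close>, and, after a tilt of slope \<open>\<epsilon>\<close>, also strictly higher than
  the line over \<open>x1\<close>. An arbitrarily small slope is enough since the ridge is stationary at \<open>a\<close>.
\<close>

lemma ridge_rises_slowly:
  assumes "\<alpha> > 0" "a > 0" "3 * a\<^sup>2 > 1" "8 * a ^ 3 - 2 * a = 1 / \<alpha>" and "\<epsilon> > 0"
  obtains x0 x1 where "a < x0" "x0 < x1" "x0 < a + 1" "height \<alpha> x0 \<ge> 1 + x0\<^sup>2"
    "ridge \<alpha> a < ridge \<alpha> x0" "ridge \<alpha> x1 - ridge \<alpha> x0 < \<epsilon> * (x1 - x0)"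
proof -
  define D where "D = (\<lambda>x. \<alpha> / x * (4 * x\<^sup>2 - height \<alpha> x))"
  have h: "height \<alpha> a = 4 * a\<^sup>2" using height_critical assms by simp
  have contH: "isCont (height \<alpha>) a"
    unfolding height_def[abs_def] using assms by (intro continuous_intros) auto
  have contD: "isCont D a"
    unfolding D_def using assms contH by (intro continuous_intros) auto
  have "(\<lambda>x. height \<alpha> x - 1 - x\<^sup>2) \<midarrow>a\<rightarrow> height \<alpha> a - 1 - a\<^sup>2"
    using contH unfolding isCont_def by (intro tendsto_intros)
  then have e1: "\<forall>\<^sub>F x in at a. height \<alpha> x - 1 - x\<^sup>2 > 0"
    by (rule order_tendstoD) (use h assms in simp)
  have e2: "\<forall>\<^sub>F x in at a. D x < \<epsilon>"
    by (rule order_tendstoD(2)[OF contD[unfolded isCont_def]]) (use h assms in \<open>simp add: D_def\<close>)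
  from eventually_conj[OF e1 e2] obtain d where d: "d > 0"
    "\<And>x. x \<noteq> a \<Longrightarrow> dist x a < d \<Longrightarrow> height \<alpha> x - 1 - x\<^sup>2 > 0 \<and> D x < \<epsilon>"
    unfolding eventually_at by auto
  define \<tau> where "\<tau> = min d 1 / 3"
  have \<tau>: "\<tau> > 0" "2 * \<tau> < d" "\<tau> < 1" using d by (auto simp: \<tau>_def)
  have near: "height \<alpha> x - 1 - x\<^sup>2 > 0" "D x < \<epsilon>" if "a < x" "x \<le> a + 2 * \<tau>" for x
    using d(2)[of x] that \<tau> by (auto simp: dist_real_def)
  have pos: "D x > 0" if "x > a" for x
  proof -
    have x: "x > 0" using that assms by simp
    have "1 / \<alpha> < 8 * x ^ 3 - 2 * x" using cubic_strict_mono[of a x] assms that by simp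
    then have "2 * x * (1 / \<alpha>) < 2 * x * (8 * x ^ 3 - 2 * x)"
      by (rule mult_strict_left_mono) (use x in simp)
    then have "2 * x / \<alpha> + 4 * x\<^sup>2 < (4 * x\<^sup>2)\<^sup>2"
      by (simp add: algebra_simps power2_eq_square power3_eq_cube)
    then have "height \<alpha> x < 4 * x\<^sup>2"
      unfolding height_def by (intro real_less_lsqrt) auto
    then show ?thesis using x assms by (simp add: D_def)
  qed
  have mvt: "\<exists>\<xi>. u < \<xi> \<and> \<xi> < v \<and> ridge \<alpha> v - ridge \<alpha> u = (v - u) * D \<xi>" if "a \<le> u" "u < v" for u v
    using that assms unfolding D_def by (intro MVT2 ridge_deriv) auto
  obtain \<xi> where "a < \<xi>" "ridge \<alpha> (a + \<tau>) - ridge \<alpha> a = \<tau> * D \<xi>"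
    using mvt[of a "a + \<tau>"] \<tau> by auto
  then have 1: "ridge \<alpha> a < ridge \<alpha> (a + \<tau>)" using pos[of \<xi>] \<tau> by (smt (verit) mult_pos_pos)
  obtain \<eta> where \<eta>: "a + \<tau> < \<eta>" "\<eta> < a + 2 * \<tau>"
      "ridge \<alpha> (a + 2 * \<tau>) - ridge \<alpha> (a + \<tau>) = \<tau> * D \<eta>"
    using mvt[of "a + \<tau>" "a + 2 * \<tau>"] \<tau> by auto
  then have "\<tau> * D \<eta> < \<tau> * \<epsilon>" using near[of \<eta>] \<tau> by (intro mult_strict_left_mono) auto
  then have 2: "ridge \<alpha> (a + 2 * \<tau>) - ridge \<alpha> (a + \<tau>) < \<epsilon> * (a + 2 * \<tau> - (a + \<tau>))"
    unfolding \<eta>(3) by (simp add: mult.commute)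
  have "height \<alpha> (a + \<tau>) \<ge> 1 + (a + \<tau>)\<^sup>2" using near(1)[of "a + \<tau>"] \<tau> by linarith
  from that[OF _ _ _ this 1 2] show ?thesis using \<tau> by simp
qed

section \<open>Cauchy's formula between vertical lines\<close>

lemma integrable_inverse_1_plus_sq: "integrable lborel (\<lambda>y::real. C / (1 + y\<^sup>2))"
  and integral_inverse_1_plus_sq: "(\<integral>y. C / (1 + y\<^sup>2) \<partial>lborel) = C * pi"
proof -
  have 1: "integrable lborel (\<lambda>y::real. inverse (1 + y\<^sup>2))"
    using integrable_inverse_1_plus_square by (simp add: set_integrable_def)
  then show "integrable lborel (\<lambda>y::real. C / (1 + y\<^sup>2))"
    unfolding divide_inverse by (rule integrable_mult_right)
  have "(\<integral>y. inverse (1 + y\<^sup>2) \<partial>lborel) = pi"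
    using LBINT_inverse_1_plus_square
    by (simp add: interval_lebesgue_integral_def set_lebesgue_integral_def)
  then show "(\<integral>y. C / (1 + y\<^sup>2) \<partial>lborel) = C * pi"
    using 1 by (simp add: divide_inverse)
qed

lemma integrable_by_inverse_square:
  fixes f :: "real \<Rightarrow> complex"
  assumes "continuous_on UNIV f" "\<And>y. norm (f y) \<le> C / (1 + y\<^sup>2)"
  shows "integrable lborel f"
  by (rule Bochner_Integration.integrable_bound[OF integrable_inverse_1_plus_sq[of C]])
     (use assms in \<open>auto intro!: borel_measurable_continuous_onI AE_I2 order_trans[OF assms(2)] divide_right_mono\<close>)

lemma norm_integral_le_inverse_square:
  fixes f :: "real \<Rightarrow> complex"
  assumes "continuous_on UNIV f" "\<And>y. norm (f y) \<le> C / (1 + y\<^sup>2)"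
  shows "norm (\<integral>y. f y \<partial>lborel) \<le> C * pi"
proof -
  have "norm (\<integral>y. f y \<partial>lborel) \<le> (\<integral>y. norm (f y) \<partial>lborel)" by (rule integral_norm_bound)
  also have "\<dots> \<le> (\<integral>y. C / (1 + y\<^sup>2) \<partial>lborel)"
    using assms integrable_inverse_1_plus_sq[of C] integrable_by_inverse_square[OF assms]
    by (intro integral_mono) auto
  finally show ?thesis by (simp add: integral_inverse_1_plus_sq)
qed

lemma integral_Icc_tendsto:
  fixes k :: "real \<Rightarrow> complex"
  assumes "integrable lborel k"
  shows "(\<lambda>n. integral {- real n..real n} k) \<longlonglongrightarrow> (\<integral>y. k y \<partial>lborel)"
proof -
  have "(\<lambda>n. \<integral>y. indicator {- real n..real n} y *\<^sub>R k y \<partial>lborel) \<longlonglongrightarrow> (\<integral>y. k y \<partial>lborel)"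
  proof (rule integral_dominated_convergence[where w = "\<lambda>y. norm (k y)"])
    show "AE y in lborel. (\<lambda>n. indicator {- real n..real n} y *\<^sub>R k y) \<longlonglongrightarrow> k y"
    proof (rule AE_I2, rule tendsto_eventually)
      fix y :: real
      obtain N :: nat where "\<bar>y\<bar> \<le> N" using real_arch_simple by blast
      then show "\<forall>\<^sub>F n in sequentially. indicator {- real n..real n} y *\<^sub>R k y = k y"
        unfolding eventually_sequentially by (intro exI[of _ N]) (auto simp: indicator_def)
    qed
  qed (use assms in \<open>auto simp: indicator_def\<close>)
  moreover have "(\<integral>y. indicator {- real n..real n} y *\<^sub>R k y \<partial>lborel) = integral {- real n..real n} k" for n
  proof -
    have "set_integrable lborel {- real n..real n} k"
      unfolding set_integrable_def using assms by (intro integrable_mult_indicator) auto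
    from set_borel_integral_eq_integral(2)[OF this] show ?thesis
      by (simp add: set_lebesgue_integral_def)
  qed
  ultimately show ?thesis by simp
qed

lemma continuous_on_Complex_Im: "continuous_on A (Complex x)"
  unfolding Complex_eq[abs_def] by (intro continuous_intros)

text \<open>
  Quadratic decay makes the horizontal sides of the rectangles disappear in the limit, so
  only the two vertical sides remain.
\<close>

lemma Cauchy_vertical_lines:
  fixes f :: "complex \<Rightarrow> complex"
  assumes S: "open S" "convex S" "f holomorphic_on S" "w \<in> S"
    and x: "x1 < x2" "Re w \<noteq> x1" "Re w \<noteq> x2"
    and strip: "\<And>z. x1 \<le> Re z \<Longrightarrow> Re z \<le> x2 \<Longrightarrow> z \<in> S"
    and bd: "\<And>z. x1 \<le> Re z \<Longrightarrow> Re z \<le> x2 \<Longrightarrow> norm (f z) \<le> C / (1 + (Im z)\<^sup>2)"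
  shows "(\<integral>y. f (Complex x2 y) / (Complex x2 y - w) \<partial>lborel)
       - (\<integral>y. f (Complex x1 y) / (Complex x1 y - w) \<partial>lborel)
       = (if x1 < Re w \<and> Re w < x2 then 2 * pi * f w else 0)"
proof -
  define g where "g = (\<lambda>z. f z / (z - w))"
  define W where "W = (if x1 < Re w \<and> Re w < x2 then 1 else 0 :: complex)"
  have C: "C \<ge> 0" using order_trans[OF norm_ge_zero bd[of "Complex x1 0"]] x by simp
  have contg: "continuous_on A g" if "A \<subseteq> S - {w}" for A
    unfolding g_def using that
    by (intro continuous_intros continuous_on_subset[OF holomorphic_on_imp_continuous_on[OF S(3)]]) auto
  have contk: "continuous_on UNIV (\<lambda>y. g (Complex x' y))" if "x1 \<le> x'" "x' \<le> x2" "x' \<noteq> Re w" for x'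
    by (rule continuous_on_compose2[OF contg[of "{z. Re z = x'}"] continuous_on_Complex_Im])
       (use that strip in auto)
  have intk: "integrable lborel (\<lambda>y. g (Complex x' y))" if "x1 \<le> x'" "x' \<le> x2" "x' \<noteq> Re w" for x'
  proof (rule integrable_by_inverse_square[OF contk[OF that], of "C / \<bar>x' - Re w\<bar>"])
    fix y
    have "\<bar>x' - Re w\<bar> \<le> norm (Complex x' y - w)" using abs_Re_le_cmod[of "Complex x' y - w"] by simp
    then have "norm (g (Complex x' y)) \<le> (C / (1 + y\<^sup>2)) / \<bar>x' - Re w\<bar>"
      unfolding g_def norm_divide using bd[of "Complex x' y"] that C
      by (intro frac_le) auto
    then show "norm (g (Complex x' y)) \<le> C / \<bar>x' - Re w\<bar> / (1 + y\<^sup>2)" by (simp add: mult.commute)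
  qed
  define V where "V = (\<lambda>x' n. integral {- real n..real n} (\<lambda>y. g (Complex x' y)))"
  define H where "H = (\<lambda>y. contour_integral (linepath (Complex x1 y) (Complex x2 y)) g)"
  have Hb: "norm (H y) \<le> C * (x2 - x1) / \<bar>y - Im w\<bar>" if "y \<noteq> Im w" for y
  proof -
    have sub: "closed_segment (Complex x1 y) (Complex x2 y) \<subseteq> {z. Im z = y \<and> x1 \<le> Re z \<and> Re z \<le> x2}"
      using x by (auto simp: closed_segment_same_Im closed_segment_eq_real_ivl)
    have sub2: "{z. Im z = y \<and> x1 \<le> Re z \<and> Re z \<le> x2} \<subseteq> S - {w}" using strip that by auto
    have "norm (H y) \<le> C / \<bar>y - Im w\<bar> * norm (Complex x2 y - Complex x1 y)"
      unfolding H_def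
    proof (rule contour_integral_bound_linepath)
      show "g contour_integrable_on linepath (Complex x1 y) (Complex x2 y)"
        by (rule contour_integrable_continuous_linepath, rule contg) (use sub sub2 in blast)
      show "0 \<le> C / \<bar>y - Im w\<bar>" using C by simp
      fix z assume "z \<in> closed_segment (Complex x1 y) (Complex x2 y)"
      then have z: "Im z = y" "x1 \<le> Re z" "Re z \<le> x2" using sub by auto
      have "norm (f z) \<le> C" 
      proof (rule order_trans[OF bd[OF z(2,3)]])
        show "C / (1 + (Im z)\<^sup>2) \<le> C"
          using frac_le[of C C 1 "1 + (Im z)\<^sup>2"] C by simp
      qed
      moreover have "\<bar>y - Im w\<bar> \<le> norm (z - w)" using abs_Im_le_cmod[of "z - w"] z by simp
      ultimately show "norm (g z) \<le> C / \<bar>y - Im w\<bar>"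
        unfolding g_def norm_divide using C that by (intro frac_le) auto
    qed
    also have "norm (Complex x2 y - Complex x1 y) = x2 - x1"
      using x by (simp add: cmod_eq_Re)
    finally show ?thesis by simp
  qed
  have key: "H (- real n) + \<i> * V x2 n - H (real n) - \<i> * V x1 n = 2 * pi * \<i> * W * f w"
    if n: "real n > \<bar>Im w\<bar>" for n
  proof -
    let ?a = "Complex x1 (- real n)" and ?b = "Complex x2 (- real n)"
    let ?c = "Complex x2 (real n)" and ?d = "Complex x1 (real n)"
    have n0: "- real n < real n" using n by linarith
    have im: "path_image (rectpath ?a ?c) \<subseteq> S - {w}"
      using x n strip by (auto simp: path_image_rectpath)
    have "winding_number (rectpath ?a ?c) w = W"
    proof (cases "x1 < Re w \<and> Re w < x2")
      case True
      then have "w \<in> box ?a ?c" using n by (auto simp: in_box_complex_iff)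
      then show ?thesis using True by (simp add: W_def winding_number_rectpath)
    next
      case False
      then have "w \<notin> cbox ?a ?c" using x by (auto simp: in_cbox_complex_iff)
      then show ?thesis using False x n0 by (simp add: W_def winding_number_rectpath_outside)
    qed
    moreover have "(g has_contour_integral (2 * pi * \<i> * winding_number (rectpath ?a ?c) w * f w)) (rectpath ?a ?c)"
      unfolding g_def using S im by (intro Cauchy_integral_formula_convex_simple[of S]) (auto simp: interior_open)
    ultimately have tot: "contour_integral (rectpath ?a ?c) g = 2 * pi * \<i> * W * f w"
      using contour_integral_unique by simp
    have rp: "rectpath ?a ?c = linepath ?a ?b +++ linepath ?b ?c +++ linepath ?c ?d +++ linepath ?d ?a"
      by (simp add: rectpath_def Let_def)
    have sub: "closed_segment ?a ?b \<subseteq> S - {w}" "closed_segment ?b ?c \<subseteq> S - {w}"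
      "closed_segment ?c ?d \<subseteq> S - {w}" "closed_segment ?d ?a \<subseteq> S - {w}"
      using im unfolding rp
      by (simp_all add: path_image_join)
    note ci = contour_integrable_continuous_linepath[OF contg]
    have "contour_integral (rectpath ?a ?c) g = contour_integral (linepath ?a ?b) g
       + (contour_integral (linepath ?b ?c) g + (contour_integral (linepath ?c ?d) g + contour_integral (linepath ?d ?a) g))"
      unfolding rp using ci[OF sub(1)] ci[OF sub(2)] ci[OF sub(3)] ci[OF sub(4)]
      by (simp add: contour_integrable_join)
    also have "contour_integral (linepath ?c ?d) g = - H (real n)"
      unfolding H_def using contg[OF sub(3)] by (rule contour_integral_reverse_linepath)
    also have "contour_integral (linepath ?d ?a) g = - contour_integral (linepath ?a ?d) g"
      using contg[OF sub(4)] by (rule contour_integral_reverse_linepath)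
    also have "contour_integral (linepath ?a ?d) g = \<i> * V x1 n"
      unfolding V_def using n0 by (intro contour_integral_linepath_same_Re) auto
    also have "contour_integral (linepath ?b ?c) g = \<i> * V x2 n"
      unfolding V_def using n0 by (intro contour_integral_linepath_same_Re) auto
    finally show ?thesis unfolding tot H_def by simp
  qed
  have lim0: "(\<lambda>n. H (s * real n)) \<longlonglongrightarrow> 0" if "s = 1 \<or> s = - 1" for s
  proof (rule Lim_null_comparison)
    have "\<forall>\<^sub>F n in sequentially. real n > \<bar>Im w\<bar>"
      using filterlim_real_sequentially by (simp add: filterlim_at_top_dense)
    then show "\<forall>\<^sub>F n in sequentially. norm (H (s * real n)) \<le> C * (x2 - x1) / (real n - \<bar>Im w\<bar>)"
    proof eventually_elim
      case (elim n)
      have le: "real n - \<bar>Im w\<bar> \<le> \<bar>s * real n - Im w\<bar>" using that by auto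
      then have "norm (H (s * real n)) \<le> C * (x2 - x1) / \<bar>s * real n - Im w\<bar>"
        using elim by (intro Hb) auto
      also have "\<dots> \<le> C * (x2 - x1) / (real n - \<bar>Im w\<bar>)"
        using le elim C x by (intro divide_left_mono mult_nonneg_nonneg mult_pos_pos) auto
      finally show ?case .
    qed
    show "(\<lambda>n. C * (x2 - x1) / (real n - \<bar>Im w\<bar>)) \<longlonglongrightarrow> 0" by real_asymp
  qed
  have lim: "(\<lambda>n. H (- real n) + \<i> * V x2 n - H (real n) - \<i> * V x1 n) \<longlonglongrightarrow>
     0 + \<i> * (\<integral>y. g (Complex x2 y) \<partial>lborel) - 0 - \<i> * (\<integral>y. g (Complex x1 y) \<partial>lborel)"
    unfolding V_def
  proof (intro tendsto_add tendsto_diff tendsto_mult tendsto_const integral_Icc_tendsto intk)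
    show "(\<lambda>n. H (- real n)) \<longlonglongrightarrow> 0" "(\<lambda>n. H (real n)) \<longlonglongrightarrow> 0"
      using lim0[of 1] lim0[of "-1"] by simp_all
  qed (use x in auto)
  have "\<forall>\<^sub>F n in sequentially. real n > \<bar>Im w\<bar>"
    using filterlim_real_sequentially by (simp add: filterlim_at_top_dense)
  then have "\<forall>\<^sub>F n in sequentially.
     H (- real n) + \<i> * V x2 n - H (real n) - \<i> * V x1 n = 2 * pi * \<i> * W * f w"
    by eventually_elim (rule key)
  from tendsto_unique[OF _ lim tendsto_eventually[OF this]]
  have "\<i> * ((\<integral>y. g (Complex x2 y) \<partial>lborel) - (\<integral>y. g (Complex x1 y) \<partial>lborel)) = \<i> * (2 * pi * W * f w)"
    by (simp add: algebra_simps)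
  then show ?thesis unfolding g_def W_def by simp
qed

section \<open>A dual lower bound for rational approximation\<close>

text \<open>
  The Cauchy transform of \<open>f\<close> along the upward line \<open>Re z = x\<close>, with \<open>dz = \<i> dy\<close> and without the usual
  factor \<open>1 / (2 \<pi>)\<close>.
\<close>

definition line_transform :: "(complex \<Rightarrow> complex) \<Rightarrow> complex \<Rightarrow> real \<Rightarrow> complex" where
  "line_transform f w x = (\<integral>y. f (Complex x y) / (Complex x y - w) \<partial>lborel)"

lemma line_transform_integrand:
  assumes "x \<noteq> Re w" "continuous_on {z. Re z = x} f"
    and "\<And>z. Re z = x \<Longrightarrow> norm (f z) \<le> C / (1 + (Im z)\<^sup>2)"
  shows "continuous_on UNIV (\<lambda>y. f (Complex x y) / (Complex x y - w))"
    and "norm (f (Complex x y) / (Complex x y - w)) \<le> C / \<bar>x - Re w\<bar> / (1 + y\<^sup>2)"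
proof -
  have "continuous_on {z. Re z = x} (\<lambda>z. f z / (z - w))"
    using assms by (intro continuous_intros) auto
  then show "continuous_on UNIV (\<lambda>y. f (Complex x y) / (Complex x y - w))"
    by (rule continuous_on_compose2[OF _ continuous_on_Complex_Im]) auto
  have C: "C \<ge> 0" using order_trans[OF norm_ge_zero assms(3)[of "Complex x 0"]] by simp
  have "\<bar>x - Re w\<bar> \<le> norm (Complex x y - w)" using abs_Re_le_cmod[of "Complex x y - w"] by simp
  then have "norm (f (Complex x y) / (Complex x y - w)) \<le> (C / (1 + y\<^sup>2)) / \<bar>x - Re w\<bar>"
    unfolding norm_divide using assms(3)[of "Complex x y"] assms(1) C
    by (intro frac_le) auto
  then show "norm (f (Complex x y) / (Complex x y - w)) \<le> C / \<bar>x - Re w\<bar> / (1 + y\<^sup>2)"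
    by (simp add: mult.commute)
qed

lemma line_transform_integrable:
  assumes "x \<noteq> Re w" "continuous_on {z. Re z = x} f"
    and "\<And>z. Re z = x \<Longrightarrow> norm (f z) \<le> C / (1 + (Im z)\<^sup>2)"
  shows "integrable lborel (\<lambda>y. f (Complex x y) / (Complex x y - w))"
  by (rule integrable_by_inverse_square[OF line_transform_integrand(1)[OF assms] line_transform_integrand(2)[OF assms]])

lemma norm_line_transform_le:
  assumes "x \<noteq> Re w" "continuous_on {z. Re z = x} f"
    and "\<And>z. Re z = x \<Longrightarrow> norm (f z) \<le> C / (1 + (Im z)\<^sup>2)"
  shows "norm (line_transform f w x) \<le> C / \<bar>x - Re w\<bar> * pi"
  unfolding line_transform_def
  by (rule norm_integral_le_inverse_square[OF line_transform_integrand(1)[OF assms] line_transform_integrand(2)[OF assms]])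

lemma line_transform_diff:
  assumes "x \<noteq> Re w" "continuous_on {z. Re z = x} f" "continuous_on {z. Re z = x} g"
    and "\<And>z. Re z = x \<Longrightarrow> norm (f z) \<le> C / (1 + (Im z)\<^sup>2)"
    and "\<And>z. Re z = x \<Longrightarrow> norm (g z) \<le> C' / (1 + (Im z)\<^sup>2)"
  shows "line_transform (\<lambda>z. f z - g z) w x = line_transform f w x - line_transform g w x"
  unfolding line_transform_def diff_divide_distrib
  by (rule Bochner_Integration.integral_diff[OF line_transform_integrable[OF assms(1,2,4)]
        line_transform_integrable[OF assms(1,3,5)]])

lemma norm_cay_le_1:
  assumes "Re z \<ge> 0"
  shows "norm (cay z) \<le> 1"
proof -
  have "(1 + Re z)\<^sup>2 + (Im z)\<^sup>2 > 0" using assms by (simp add: add_pos_nonneg)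
  moreover have "(1 - Re z)\<^sup>2 \<le> (1 + Re z)\<^sup>2"
    using assms by (simp add: power2_eq_square algebra_simps)
  ultimately have "(norm (cay z))\<^sup>2 \<le> 1"
    unfolding norm_cay_sq by (simp add: divide_le_eq_1_pos)
  then show ?thesis by (metis abs_norm_cancel abs_square_le_1)
qed

lemma norm_1_plus_sq:
  assumes "Re z \<ge> 0"
  shows "1 + (Im z)\<^sup>2 \<le> (norm (1 + z))\<^sup>2"
  using assms unfolding cmod_power2 by (simp add: power2_eq_square algebra_simps)

lemma divide_1_plus_sq_le:
  assumes "Re z \<ge> 0" "norm c \<le> C"
  shows "norm (c / (1 + z)\<^sup>2) \<le> C / (1 + (Im z)\<^sup>2)"
  unfolding norm_divide norm_power
  using assms order_trans[OF norm_ge_zero assms(2)] norm_1_plus_sq[OF assms(1)]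
  by (intro frac_le) (auto intro: add_pos_nonneg)

lemma one_minus_norm_cay:
  assumes "Re z > 0"
  shows "1 - norm (cay z) \<ge> 2 * Re z / (norm (1 + z))\<^sup>2"
proof -
  have n: "(norm (1 + z))\<^sup>2 = (1 + Re z)\<^sup>2 + (Im z)\<^sup>2" by (simp add: cmod_power2)
  have pos: "(1 + Re z)\<^sup>2 + (Im z)\<^sup>2 > 0" using assms by (simp add: add_pos_nonneg)
  have "4 * Re z / (norm (1 + z))\<^sup>2 = 1 - (norm (cay z))\<^sup>2"
  proof -
    have "1 - (norm (cay z))\<^sup>2 = (((1 + Re z)\<^sup>2 + (Im z)\<^sup>2) - ((1 - Re z)\<^sup>2 + (Im z)\<^sup>2))
        / ((1 + Re z)\<^sup>2 + (Im z)\<^sup>2)"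
      unfolding norm_cay_sq diff_divide_distrib
      by (simp only: divide_self[OF less_imp_neq[OF pos, symmetric]])
    also have "((1 + Re z)\<^sup>2 + (Im z)\<^sup>2) - ((1 - Re z)\<^sup>2 + (Im z)\<^sup>2) = 4 * Re z"
      by (simp add: power2_eq_square algebra_simps)
    finally show ?thesis by (simp add: n)
  qed
  also have "\<dots> = (1 - norm (cay z)) * (1 + norm (cay z))" by (simp add: power2_eq_square algebra_simps)
  also have "\<dots> \<le> (1 - norm (cay z)) * 2"
    using norm_cay_le_1[of z] assms by (intro mult_left_mono) auto
  finally show ?thesis by simp
qed

text \<open>
  With \<open>z\<^sup>2\<close> as variable, \<open>P(z\<^sup>2) / (1 - z\<^sup>2) ^ m\<close> times \<open>b(z) ^ m\<close> is \<open>P(z\<^sup>2) / (1 + z) ^ (2 m)\<close>: the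
  Cayley factor removes the pole at 1, and what is left is bounded in the right half-plane.
\<close>

lemma poly_square_bounded:
  fixes P :: "complex poly"
  assumes "degree P \<le> m" "Re z \<ge> 0"
  shows "norm (poly P (z\<^sup>2) / (1 + z) ^ (2 * m)) \<le> (\<Sum>k\<le>degree P. norm (coeff P k))"
proof -
  have "(Re z)\<^sup>2 \<le> (1 + Re z)\<^sup>2" "1 \<le> (1 + Re z)\<^sup>2"
    using assms by (auto simp: power2_eq_square algebra_simps)
  then have "(norm z)\<^sup>2 \<le> (norm (1 + z))\<^sup>2" "1 \<le> (norm (1 + z))\<^sup>2"
    by (auto simp: cmod_power2 add_increasing2)
  then have z1: "norm z \<le> norm (1 + z)" "1 \<le> norm (1 + z)"
    by (auto intro: power2_le_imp_le[of "norm z"] power2_le_imp_le[of 1])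
  have "norm (poly P (z\<^sup>2)) \<le> (\<Sum>k\<le>degree P. norm (coeff P k) * norm z ^ (2 * k))"
    unfolding poly_altdef by (rule order_trans[OF norm_sum]) (simp add: norm_mult norm_power power_mult)
  also have "\<dots> \<le> (\<Sum>k\<le>degree P. norm (coeff P k) * norm (1 + z) ^ (2 * m))"
  proof (intro sum_mono mult_left_mono)
    fix k assume "k \<in> {..degree P}"
    then have "norm (1 + z) ^ (2 * k) \<le> norm (1 + z) ^ (2 * m)"
      using assms z1 by (intro power_increasing) auto
    moreover have "norm z ^ (2 * k) \<le> norm (1 + z) ^ (2 * k)" using z1 by (intro power_mono) auto
    ultimately show "norm z ^ (2 * k) \<le> norm (1 + z) ^ (2 * m)" by linarith
  qed auto
  finally have "norm (poly P (z\<^sup>2)) \<le> (\<Sum>k\<le>degree P. norm (coeff P k)) * norm (1 + z) ^ (2 * m)"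
    by (simp only: sum_distrib_right)
  moreover have "norm (1 + z) ^ (2 * m) > 0" using z1 by (intro zero_less_power) linarith
  ultimately show ?thesis
    unfolding norm_divide norm_power by (simp add: pos_divide_le_eq)
qed

lemma halfplane_open_convex: "open {z. Re z > c}" "convex {z. Re z > c}"
  by (rule open_halfspace_Re_gt convex_halfspace_Re_gt)+

text \<open>
  The test function is \<open>h(z) = (1 - B(z)) / (z - w)\<close> with \<open>B(z) = exp (- n (z - w))\<close>, damped by
  \<open>1 / (1 + z)\<^sup>2\<close> for integrability. The numerator vanishes at \<open>w\<close>, so the rational function contributes
  nothing (shift the line to the right). The exponential contributes \<open>KA\<close> from the summand 1 moved to \<open>Re z = a\<close>,
  and \<open>KB\<close> together with the residue at \<open>w\<close> from the summand \<open>B\<close> moved to \<open>Re z = x1\<close>.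
\<close>

lemma rational_error_duality:
  fixes P :: "complex poly" and l n a x1 E KA KB :: real and w :: complex
  assumes P: "degree P \<le> m"
    and E: "\<And>s::real. s \<le> 0 \<Longrightarrow> norm (of_real (exp (l * s)) - poly P (of_real s) / (1 - of_real s) ^ m) \<le> E"
    and l: "l \<ge> 0" and n: "n \<ge> 0" and x: "0 < a" "a < Re w" "Re w < x1"
    and KA: "\<And>z. Re z = a \<Longrightarrow> norm (exp (of_real l * z\<^sup>2)) * norm (cay z) ^ m \<le> KA"
    and KB: "\<And>z. Re z = x1 \<Longrightarrow> norm (exp (of_real l * z\<^sup>2)) * norm (cay z) ^ m \<le> KB"
  shows "2 * (norm (exp (of_real l * w\<^sup>2)) * norm (cay w) ^ m / (norm (1 + w))\<^sup>2)
     \<le> E * (1 + exp (n * Re w)) / Re w + KA / (Re w - a) + KB * exp (- n * (x1 - Re w)) / (x1 - Re w)"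
proof -
  define S where "S = {z. Re z > -1}"
  have S: "open S" "convex S" unfolding S_def by (rule halfplane_open_convex)+
  have wS: "w \<in> S" using x by (simp add: S_def)
  have S1: "1 + z \<noteq> 0" if "z \<in> S" for z using that by (auto simp: S_def complex_eq_iff)
  have line: "z \<in> S" if "Re z \<ge> 0" for z using that by (simp add: S_def)
  define f where "f = (\<lambda>z. exp (of_real l * z\<^sup>2) * cay z ^ m / (1 + z)\<^sup>2)"
  define B where "B = (\<lambda>z. exp (- of_real n * (z - w)))"
  define u where "u = (\<lambda>z. poly P (z\<^sup>2) / (1 + z) ^ (2 * m) / (1 + z)\<^sup>2)"
  have hf: "f holomorphic_on S" unfolding f_def cay_def using S1 by (intro holomorphic_intros) auto
  have hB: "B holomorphic_on S" unfolding B_def by (intro holomorphic_intros)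
  have hu: "u holomorphic_on S" unfolding u_def using S1 by (intro holomorphic_intros) auto
  have hfB: "(\<lambda>z. f z * B z) holomorphic_on S" using hf hB by (intro holomorphic_intros)
  have huB: "(\<lambda>z. u z * (1 - B z)) holomorphic_on S" using hu hB by (intro holomorphic_intros)
  have cont: "continuous_on {z. Re z = c} h" if "h holomorphic_on S" "c \<ge> 0" for h c
    by (rule continuous_on_subset[OF holomorphic_on_imp_continuous_on[OF that(1)]]) (use that line in auto)
  have nB: "norm (B z) = exp (- n * (Re z - Re w))" for z by (simp add: B_def)
  have B_le: "norm (B z) \<le> exp (n * Re w)" if "Re z \<ge> 0" for z
    using that n by (simp add: nB algebra_simps)
  have fl: "norm (f z) \<le> K / (1 + (Im z)\<^sup>2)"
    if "Re z \<ge> 0" "norm (exp (of_real l * z\<^sup>2)) * norm (cay z) ^ m \<le> K" for z K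
    unfolding f_def using that by (intro divide_1_plus_sq_le) (auto simp: norm_mult norm_power)
  have f_strip: "norm (f z) \<le> exp (l * x1\<^sup>2) / (1 + (Im z)\<^sup>2)" if "0 \<le> Re z" "Re z \<le> x1" for z
  proof (rule fl)
    have "(Re z)\<^sup>2 - (Im z)\<^sup>2 \<le> x1\<^sup>2" using power_mono[OF that(2,1), of 2] by (simp add: add_increasing2 diff_le_eq)
    then have "norm (exp (of_real l * z\<^sup>2)) \<le> exp (l * x1\<^sup>2)"
      unfolding norm_exp_sq using l by (simp add: mult_left_mono)
    moreover have "norm (cay z) ^ m \<le> 1" using norm_cay_le_1[OF that(1)] by (simp add: power_le_one)
    ultimately show "norm (exp (of_real l * z\<^sup>2)) * norm (cay z) ^ m \<le> exp (l * x1\<^sup>2)"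
      using mult_mono[of _ "exp (l * x1\<^sup>2)" _ 1] by simp
  qed (use that in auto)
  have fB_strip: "norm (f z * B z) \<le> exp (l * x1\<^sup>2) * exp (n * Re w) / (1 + (Im z)\<^sup>2)"
    if "0 \<le> Re z" "Re z \<le> x1" for z
    using mult_mono[OF f_strip[OF that] B_le[OF that(1)]] by (simp add: norm_mult)
  define CP where "CP = (\<Sum>k\<le>degree P. norm (coeff P k))"
  have CP: "CP \<ge> 0" unfolding CP_def by (intro sum_nonneg) auto
  have one_minus_B: "norm (1 - B z) \<le> 1 + exp (n * Re w)" if "Re z \<ge> 0" for z
    using norm_triangle_ineq4[of 1 "B z"] B_le[OF that] by simp
  have u_bd: "norm (u z * (1 - B z)) \<le> CP * (1 + exp (n * Re w)) / (1 + (Im z)\<^sup>2)" if "Re z \<ge> 0" for z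
  proof -
    have "norm (u z) \<le> CP / (1 + (Im z)\<^sup>2)"
      unfolding u_def CP_def by (intro divide_1_plus_sq_le poly_square_bounded that P)
    from mult_mono[OF this one_minus_B[OF that]] show ?thesis using CP by (simp add: norm_mult)
  qed
  \<comment> \<open>no pole at \<open>w\<close>: the integral over \<open>Re z = X\<close> does not depend on \<open>X\<close> and is \<open>O(1 / X)\<close>\<close>
  have orth: "line_transform (\<lambda>z. u z * (1 - B z)) w 0 = 0"
  proof -
    define c where "c = CP * (1 + exp (n * Re w)) * pi"
    have c: "c \<ge> 0" using CP by (simp add: c_def add_nonneg_nonneg)
    have "norm (line_transform (\<lambda>z. u z * (1 - B z)) w 0) \<le> c / (X - Re w)" if X: "X > Re w" for X
    proof -
      have "line_transform (\<lambda>z. u z * (1 - B z)) w X - line_transform (\<lambda>z. u z * (1 - B z)) w 0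
          = (if 0 < Re w \<and> Re w < X then 2 * pi * (u w * (1 - B w)) else 0)"
        unfolding line_transform_def
        by (rule Cauchy_vertical_lines[OF S huB wS]) (use x X line u_bd in auto)
      also have "\<dots> = 0" by (simp add: B_def)
      finally have "line_transform (\<lambda>z. u z * (1 - B z)) w 0 = line_transform (\<lambda>z. u z * (1 - B z)) w X" by simp
      moreover have "norm (line_transform (\<lambda>z. u z * (1 - B z)) w X) \<le> CP * (1 + exp (n * Re w)) / \<bar>X - Re w\<bar> * pi"
        by (rule norm_line_transform_le) (use x X u_bd cont[OF huB] in auto)
      ultimately show ?thesis using X by (simp add: c_def)
    qed
    then have "\<forall>\<^sub>F X in at_top. norm (line_transform (\<lambda>z. u z * (1 - B z)) w 0) \<le> c / (X - Re w)"
      by (rule eventually_mono[OF eventually_gt_at_top[of "Re w"]])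
    moreover have "((\<lambda>X. c / (X - Re w)) \<longlongrightarrow> 0) at_top" by real_asymp
    ultimately have "norm (line_transform (\<lambda>z. u z * (1 - B z)) w 0) \<le> 0"
      by (intro tendsto_lowerbound) auto
    then show ?thesis by simp
  qed
  have E0: "E \<ge> 0" using order_trans[OF norm_ge_zero E[of 0]] by simp
  \<comment> \<open>on the imaginary axis the Cayley factor is unimodular, so the error enters without loss\<close>
  have diff_bd: "norm ((f z - f z * B z) - u z * (1 - B z)) \<le> E * (1 + exp (n * Re w)) / (1 + (Im z)\<^sup>2)"
    if z: "Re z = 0" for z
  proof -
    have z2: "z\<^sup>2 = of_real (- (Im z)\<^sup>2)" using z by (simp add: complex_eq_iff power2_eq_square)
    have nz: "1 + z \<noteq> 0" using S1 line z by simp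
    have nz': "1 - z \<noteq> 0" using z by (auto simp: complex_eq_iff)
    have "1 - z\<^sup>2 = (1 - z) * (1 + z)" by (simp add: power2_eq_square algebra_simps)
    then have "cay z ^ m / (1 - z\<^sup>2) ^ m = 1 / (1 + z) ^ (2 * m)"
      using nz nz' by (simp add: cay_def power_divide power_mult_distrib divide_simps power_mult power2_eq_square)
    moreover have "(poly P (z\<^sup>2) / (1 - z\<^sup>2) ^ m) * cay z ^ m
        = poly P (z\<^sup>2) * (cay z ^ m / (1 - z\<^sup>2) ^ m)" by simp
    ultimately have "(poly P (z\<^sup>2) / (1 - z\<^sup>2) ^ m) * cay z ^ m = poly P (z\<^sup>2) / (1 + z) ^ (2 * m)"
      by (simp only:) simp
    then have "u z = (poly P (z\<^sup>2) / (1 - z\<^sup>2) ^ m) * cay z ^ m / (1 + z)\<^sup>2"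
      unfolding u_def by (simp only:)
    then have "f z - u z = (exp (of_real l * z\<^sup>2) - poly P (z\<^sup>2) / (1 - z\<^sup>2) ^ m) * cay z ^ m / (1 + z)\<^sup>2"
      by (simp add: f_def algebra_simps diff_divide_distrib)
    moreover have "norm ((exp (of_real l * z\<^sup>2) - poly P (z\<^sup>2) / (1 - z\<^sup>2) ^ m) * cay z ^ m) \<le> E"
    proof -
      have "norm (exp (of_real l * z\<^sup>2) - poly P (z\<^sup>2) / (1 - z\<^sup>2) ^ m) \<le> E"
        unfolding z2 using E[of "- (Im z)\<^sup>2"] by (simp flip: exp_of_real)
      moreover have "norm (cay z) ^ m \<le> 1" using norm_cay_le_1 z by (simp add: power_le_one)
      ultimately show ?thesis using mult_mono[of _ E "norm (cay z) ^ m" 1] E0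
        by (simp add: norm_mult norm_power)
    qed
    ultimately have "norm (f z - u z) \<le> E / (1 + (Im z)\<^sup>2)"
      using z by (simp only:) (intro divide_1_plus_sq_le, auto)
    from mult_mono[OF this one_minus_B[of z]] z E0 show ?thesis
      by (simp add: algebra_simps flip: norm_mult)
  qed
  have I0: "norm (line_transform (\<lambda>z. f z - f z * B z) w 0) \<le> E * (1 + exp (n * Re w)) / Re w * pi"
  proof -
    have "norm (line_transform (\<lambda>z. (f z - f z * B z) - u z * (1 - B z)) w 0)
       \<le> E * (1 + exp (n * Re w)) / \<bar>0 - Re w\<bar> * pi"
      by (rule norm_line_transform_le) (use x diff_bd cont hf hB hu in \<open>auto intro!: cont holomorphic_intros\<close>)
    moreover have "line_transform (\<lambda>z. (f z - f z * B z) - u z * (1 - B z)) w 0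
      = line_transform (\<lambda>z. f z - f z * B z) w 0 - line_transform (\<lambda>z. u z * (1 - B z)) w 0"
    proof (rule line_transform_diff)
      fix z assume z: "Re z = 0"
      show "norm (f z - f z * B z) \<le> (exp (l * x1\<^sup>2) + exp (l * x1\<^sup>2) * exp (n * Re w)) / (1 + (Im z)\<^sup>2)"
        using norm_triangle_ineq4[of "f z" "f z * B z"] f_strip[of z] fB_strip[of z] x z
        by (simp add: add_divide_distrib)
      show "norm (u z * (1 - B z)) \<le> CP * (1 + exp (n * Re w)) / (1 + (Im z)\<^sup>2)"
        using u_bd z by simp
    qed (use x cont hf hB hu in \<open>auto intro!: cont holomorphic_intros\<close>)
    ultimately show ?thesis using orth x by simp
  qed
  have split: "line_transform (\<lambda>z. f z - f z * B z) w 0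
     = line_transform f w 0 - line_transform (\<lambda>z. f z * B z) w 0"
    by (rule line_transform_diff[where C = "exp (l * x1\<^sup>2)" and C' = "exp (l * x1\<^sup>2) * exp (n * Re w)"])
       (use x f_strip fB_strip cont hf hfB in auto)
  \<comment> \<open>the pole lies to the right of both lines\<close>
  have A: "line_transform f w a = line_transform f w 0"
  proof -
    have "line_transform f w a - line_transform f w 0 = (if 0 < Re w \<and> Re w < a then 2 * pi * f w else 0)"
      unfolding line_transform_def
      by (rule Cauchy_vertical_lines[OF S hf wS, where C = "exp (l * x1\<^sup>2)"]) (use x line f_strip in auto)
    then show ?thesis using x by simp
  qed
  \<comment> \<open>this shift crosses the pole, where \<open>B w = 1\<close>\<close>
  have B: "line_transform (\<lambda>z. f z * B z) w x1 - line_transform (\<lambda>z. f z * B z) w 0 = 2 * pi * f w"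
  proof -
    have "line_transform (\<lambda>z. f z * B z) w x1 - line_transform (\<lambda>z. f z * B z) w 0
       = (if 0 < Re w \<and> Re w < x1 then 2 * pi * (f w * B w) else 0)"
      unfolding line_transform_def
      by (rule Cauchy_vertical_lines[OF S hfB wS, where C = "exp (l * x1\<^sup>2) * exp (n * Re w)"]) (use x line fB_strip in auto)
    then show ?thesis using x by (simp add: B_def)
  qed
  have nA: "norm (line_transform f w a) \<le> KA / (Re w - a) * pi"
  proof -
    have "norm (line_transform f w a) \<le> KA / \<bar>a - Re w\<bar> * pi"
      by (rule norm_line_transform_le) (use x fl KA cont[OF hf] in auto)
    then show ?thesis using x by (simp add: abs_if)
  qed
  have nB': "norm (line_transform (\<lambda>z. f z * B z) w x1) \<le> KB * exp (- n * (x1 - Re w)) / (x1 - Re w) * pi"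
  proof -
    have "norm (f z * B z) \<le> KB * exp (- n * (x1 - Re w)) / (1 + (Im z)\<^sup>2)" if "Re z = x1" for z
      using mult_right_mono[OF fl[of z KB], of "norm (B z)"] KB[OF that] that x by (simp add: norm_mult nB)
    then have "norm (line_transform (\<lambda>z. f z * B z) w x1) \<le> KB * exp (- n * (x1 - Re w)) / \<bar>x1 - Re w\<bar> * pi"
      by (intro norm_line_transform_le) (use x cont[OF hfB] in auto)
    then show ?thesis using x by (simp add: abs_if)
  qed
  have "2 * pi * f w = line_transform (\<lambda>z. f z - f z * B z) w 0 - line_transform f w a
      + line_transform (\<lambda>z. f z * B z) w x1"
    unfolding split A using B by (simp add: algebra_simps)
  then have "norm (2 * pi * f w) \<le> norm (line_transform (\<lambda>z. f z - f z * B z) w 0)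
     + norm (line_transform f w a) + norm (line_transform (\<lambda>z. f z * B z) w x1)"
    using order_trans[OF norm_triangle_ineq add_right_mono[OF norm_triangle_ineq4]] by (rule ssubst[where P = "\<lambda>v. norm v \<le> _"])
  also have "\<dots> \<le> (E * (1 + exp (n * Re w)) / Re w + KA / (Re w - a)
     + KB * exp (- n * (x1 - Re w)) / (x1 - Re w)) * pi"
    using add_mono[OF add_mono[OF I0 nA] nB'] by (simp only: distrib_right)
  also have "norm (2 * pi * f w) = 2 * norm (f w) * pi" by (simp add: norm_mult)
  finally have "2 * norm (f w) \<le> E * (1 + exp (n * Re w)) / Re w + KA / (Re w - a)
     + KB * exp (- n * (x1 - Re w)) / (x1 - Re w)"
    by (rule mult_right_le_imp_le) simp
  then show ?thesis by (simp add: f_def norm_divide norm_mult norm_power)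
qed

section \<open>Truncated Chebyshev expansion\<close>

lemma exp_neg_square_le: "exp (- (y::real)\<^sup>2) \<le> 2 / (1 + y\<^sup>2)\<^sup>2"
proof -
  have "1 + y\<^sup>2 + (y\<^sup>2)\<^sup>2 / 2 \<le> exp (y\<^sup>2)" by (rule exp_lower_Taylor_quadratic) simp
  then have "(1 + y\<^sup>2)\<^sup>2 \<le> 2 * exp (y\<^sup>2)" by (simp add: power2_eq_square algebra_simps)
  moreover have "(1 + y\<^sup>2)\<^sup>2 > 0" by (intro zero_less_power add_pos_nonneg) auto
  ultimately have "2 / (2 * exp (y\<^sup>2)) \<le> 2 / (1 + y\<^sup>2)\<^sup>2"
    by (intro divide_left_mono mult_pos_pos) auto
  then show ?thesis by (simp add: exp_minus inverse_eq_divide)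
qed

text \<open>
  These are twice the Chebyshev polynomials of the first kind, characterised by their values under the
  Joukowski map.
\<close>

lemma ex_chebyshev_poly:
  "\<exists>T :: complex poly. degree T \<le> k \<and> (\<forall>\<beta>. \<beta> \<noteq> 0 \<longrightarrow> poly T ((\<beta> + 1 / \<beta>) / 2) = \<beta> ^ k + 1 / \<beta> ^ k)"
proof (induction k rule: induct_nat_012)
  case 0
  show ?case by (intro exI[of _ "[:2:]"]) auto
next
  case 1
  show ?case by (intro exI[of _ "[:0, 2:]"]) (auto simp: field_simps)
next
  case (ge2 k)
  then obtain T0 T1 :: "complex poly" where
    T: "degree T0 \<le> k" "degree T1 \<le> Suc k"
      "\<And>\<beta>. \<beta> \<noteq> 0 \<Longrightarrow> poly T0 ((\<beta> + 1 / \<beta>) / 2) = \<beta> ^ k + 1 / \<beta> ^ k"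
      "\<And>\<beta>. \<beta> \<noteq> 0 \<Longrightarrow> poly T1 ((\<beta> + 1 / \<beta>) / 2) = \<beta> ^ Suc k + 1 / \<beta> ^ Suc k" by metis
  have "degree (pCons 0 (smult 2 T1) - T0) \<le> Suc (Suc k)"
    using T by (intro degree_diff_le order_trans[OF degree_pCons_le]) auto
  moreover have "poly (pCons 0 (smult 2 T1) - T0) ((\<beta> + 1 / \<beta>) / 2) = \<beta> ^ Suc (Suc k) + 1 / \<beta> ^ Suc (Suc k)"
    if "\<beta> \<noteq> 0" for \<beta>
  proof -
    have "poly (pCons 0 (smult 2 T1) - T0) ((\<beta> + 1 / \<beta>) / 2)
        = (\<beta> + 1 / \<beta>) * (\<beta> ^ Suc k + 1 / \<beta> ^ Suc k) - (\<beta> ^ k + 1 / \<beta> ^ k)"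
      unfolding T(3)[OF that, symmetric] T(4)[OF that, symmetric] by simp
    also have "\<dots> = \<beta> ^ Suc (Suc k) + 1 / \<beta> ^ Suc (Suc k)"
      using that by (simp add: field_simps)
    finally show ?thesis .
  qed
  ultimately show ?case by blast
qed

lemma geometric_remainder:
  fixes b \<beta> :: "'a::field"
  assumes "\<beta> \<noteq> 0" "\<beta> \<noteq> b"
  shows "1 / (\<beta> - b) = (\<Sum>k<m. b ^ k / \<beta> ^ Suc k) + (b / \<beta>) ^ m / (\<beta> - b)"
proof (induction m)
  case (Suc m)
  have "(b / \<beta>) ^ m / (\<beta> - b) = b ^ m / \<beta> ^ Suc m + (b / \<beta>) ^ Suc m / (\<beta> - b)"
    using assms by (simp add: field_simps power_divide)
  then show ?case using Suc by simp
qed simp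

lemma cauchy_kernel_cay:
  assumes "1 + z \<noteq> 0" "1 + z0 \<noteq> 0" "z \<noteq> z0"
  shows "1 / (z - z0) = (1 + cay z0) / ((1 + z) * (cay z0 - cay z))"
proof -
  have 1: "1 + cay z0 = 2 / (1 + z0)"
    using assms by (simp add: cay_def divide_simps)
  have "cay z0 - cay z = ((1 - z0) * (1 + z) - (1 - z) * (1 + z0)) / ((1 + z0) * (1 + z))"
    unfolding cay_def using assms by (simp add: diff_frac_eq)
  also have "(1 - z0) * (1 + z) - (1 - z) * (1 + z0) = 2 * (z - z0)" by (simp add: algebra_simps)
  finally have 2: "cay z0 - cay z = 2 * (z - z0) / ((1 + z0) * (1 + z))" .
  show ?thesis unfolding 1 2 using assms by (simp add: divide_simps) (simp add: algebra_simps)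
qed

text \<open>
  At \<open>x = (\<beta> + 1 / \<beta>) / 2\<close> this is \<open>2 (T\<^sub>k\<^sub>+\<^sub>1(x) + T\<^sub>k(x))\<close> for the Chebyshev polynomials \<open>T\<^sub>k\<close>. Each of these
  sums vanishes at \<open>x = -1\<close>, as the target does.
\<close>

definition cheb_weight :: "nat \<Rightarrow> complex \<Rightarrow> complex" where
  "cheb_weight k \<beta> = (\<beta> ^ Suc k + 1 / \<beta> ^ Suc k) + (\<beta> ^ k + 1 / \<beta> ^ k)"

lemma cay_uminus:
  assumes "1 + z \<noteq> 0" "1 - z \<noteq> 0"
  shows "cay (- z) = 1 / cay z"
  using assms by (simp add: cay_def)

text \<open>
  Replacing \<open>z0\<close> by \<open>- z0\<close> replaces \<open>\<beta> = b(z0)\<close> by \<open>1 / \<beta>\<close>. The two geometric expansions of the kernels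
  therefore combine into terms symmetric in \<open>\<beta>\<close> and \<open>1 / \<beta>\<close>, that is, into polynomials in \<open>x\<close>.
\<close>

lemma kernel_expansion:
  assumes z: "Re z > 0" and z0: "Re z0 = 0"
  shows "norm (1 / (z - z0) + 1 / (z + z0) - (\<Sum>k<m. cay z ^ k / (1 + z) * cheb_weight k (cay z0)))
     \<le> 2 * norm (cay z) ^ m * norm (1 + z) / Re z"
proof -
  define b \<beta> where "b = cay z" and "\<beta> = cay z0"
  have nz: "1 + z \<noteq> 0" "1 + z0 \<noteq> 0" "1 - z0 \<noteq> 0" "z \<noteq> z0" "z \<noteq> - z0"
    using z z0 by (auto simp: complex_eq_iff)
  have gap: "1 - norm b \<ge> 2 * Re z / (norm (1 + z))\<^sup>2"
    unfolding b_def using one_minus_norm_cay[OF z] .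
  have zpos: "norm (1 + z) > 0" using nz by simp
  then have gpos: "2 * Re z / (norm (1 + z))\<^sup>2 > 0" using z by simp
  then have b1: "norm b < 1" using gap by linarith
  have n\<beta>: "norm \<beta> = 1"
  proof -
    have "norm (1 - z0) = norm (1 + z0)" using z0 by (simp add: cmod_def)
    then show ?thesis using nz by (simp add: \<beta>_def cay_def norm_divide)
  qed
  then have \<beta>0: "\<beta> \<noteq> 0" by auto
  have ne: "\<beta> \<noteq> b" "1 / \<beta> \<noteq> b" using b1 n\<beta> by (auto simp: norm_divide)
  have k1: "1 / (z - z0) = (1 + \<beta>) / (1 + z) * (1 / (\<beta> - b))"
    unfolding b_def \<beta>_def using cauchy_kernel_cay[of z z0] nz by simp
  have k2: "1 / (z + z0) = (1 + 1 / \<beta>) / (1 + z) * (1 / (1 / \<beta> - b))"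
    unfolding b_def \<beta>_def using cauchy_kernel_cay[of z "- z0"] cay_uminus[of z0] nz
    by (simp add: add_eq_0_iff)
  define R where "R = (1 + \<beta>) / (1 + z) * ((b / \<beta>) ^ m / (\<beta> - b))
      + (1 + 1 / \<beta>) / (1 + z) * ((b / (1 / \<beta>)) ^ m / (1 / \<beta> - b))"
  have w: "(1 + \<beta>) * (b ^ k / \<beta> ^ Suc k) + (1 + 1 / \<beta>) * (b ^ k / (1 / \<beta>) ^ Suc k) = b ^ k * cheb_weight k \<beta>" for k
    unfolding cheb_weight_def using \<beta>0 by (simp add: field_simps power_divide)
  have "1 / (z - z0) + 1 / (z + z0) = (1 + \<beta>) / (1 + z) * (\<Sum>k<m. b ^ k / \<beta> ^ Suc k)
      + (1 + 1 / \<beta>) / (1 + z) * (\<Sum>k<m. b ^ k / (1 / \<beta>) ^ Suc k) + R"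
    unfolding k1 k2 R_def using geometric_remainder[of \<beta> b m] geometric_remainder[of "1 / \<beta>" b m] \<beta>0 ne
    by (simp add: algebra_simps)
  also have "(1 + \<beta>) / (1 + z) * (\<Sum>k<m. b ^ k / \<beta> ^ Suc k)
      + (1 + 1 / \<beta>) / (1 + z) * (\<Sum>k<m. b ^ k / (1 / \<beta>) ^ Suc k)
      = (\<Sum>k<m. ((1 + \<beta>) * (b ^ k / \<beta> ^ Suc k) + (1 + 1 / \<beta>) * (b ^ k / (1 / \<beta>) ^ Suc k)) / (1 + z))"
  proof -
    have "A / c * X + A' / c * Y = (A * X + A' * Y) / c" for A A' c X Y :: complex
      by (simp add: add_divide_distrib)
    then show ?thesis unfolding sum_distrib_left sum.distrib[symmetric] by (intro sum.cong refl)
  qed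
  also have "\<dots> = (\<Sum>k<m. b ^ k / (1 + z) * cheb_weight k \<beta>)"
    unfolding w by simp
  finally have eq: "1 / (z - z0) + 1 / (z + z0) - (\<Sum>k<m. b ^ k / (1 + z) * cheb_weight k \<beta>) = R" by simp
  have part: "norm ((1 + \<gamma>) / (1 + z) * ((b / \<gamma>) ^ m / (\<gamma> - b))) \<le> norm b ^ m * norm (1 + z) / Re z"
    if g: "norm \<gamma> = 1" for \<gamma>
  proof -
    have "2 * Re z / (norm (1 + z))\<^sup>2 \<le> norm (\<gamma> - b)"
      using norm_triangle_ineq2[of \<gamma> b] gap g by linarith
    then have "norm b ^ m / norm (\<gamma> - b) \<le> norm b ^ m / (2 * Re z / (norm (1 + z))\<^sup>2)"
      using gpos by (intro divide_left_mono mult_pos_pos) auto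
    moreover have "norm (1 + \<gamma>) / norm (1 + z) \<le> 2 / norm (1 + z)"
      using norm_triangle_ineq[of 1 \<gamma>] g by (intro divide_right_mono) auto
    ultimately have "norm (1 + \<gamma>) / norm (1 + z) * (norm b ^ m / norm (\<gamma> - b))
       \<le> 2 / norm (1 + z) * (norm b ^ m / (2 * Re z / (norm (1 + z))\<^sup>2))"
      by (intro mult_mono) auto
    also have "\<dots> = norm b ^ m * norm (1 + z) / Re z"
      using zpos z by (simp add: power2_eq_square)
    finally show ?thesis using g by (simp add: norm_mult norm_divide norm_power power_divide)
  qed
  have "norm R \<le> norm b ^ m * norm (1 + z) / Re z + norm b ^ m * norm (1 + z) / Re z"
    unfolding R_def using n\<beta> by (intro order_trans[OF norm_triangle_ineq] add_mono part) (auto simp: norm_divide)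
  then show ?thesis using eq by (simp add: b_def \<beta>_def mult_ac)
qed

lemma lborel_integral_uminus:
  fixes f :: "real \<Rightarrow> complex"
  shows "(\<integral>y. f (- y) \<partial>lborel) = (\<integral>y. f y \<partial>lborel)"
  using lborel_integral_real_affine[of "-1" f 0] by simp

lemma gaussian_bound:
  assumes "l > 0" "\<bar>Re z\<bar> \<le> a"
  shows "norm (exp (of_real l * z\<^sup>2)) \<le> exp (l * a\<^sup>2) * (1 + 1 / l) / (1 + (Im z)\<^sup>2)"
proof -
  have "(1 + l * (Im z)\<^sup>2) * (1 + 1 / l) = (1 + (Im z)\<^sup>2) + (1 / l + l * (Im z)\<^sup>2)"
    using assms by (simp add: field_simps)
  moreover have "1 / l + l * (Im z)\<^sup>2 \<ge> 0" using assms by simp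
  ultimately have "1 + (Im z)\<^sup>2 \<le> (1 + l * (Im z)\<^sup>2) * (1 + 1 / l)" by linarith
  also have "\<dots> \<le> exp (l * (Im z)\<^sup>2) * (1 + 1 / l)"
    using assms by (intro mult_right_mono exp_ge_add_one_self) auto
  finally have 1: "exp (- l * (Im z)\<^sup>2) \<le> (1 + 1 / l) / (1 + (Im z)\<^sup>2)"
    using assms by (simp add: exp_minus field_simps add_pos_nonneg)
  have "(Re z)\<^sup>2 \<le> a\<^sup>2" using power_mono[of "\<bar>Re z\<bar>" a 2] assms by simp
  then have "norm (exp (of_real l * z\<^sup>2)) \<le> exp (l * a\<^sup>2) * exp (- l * (Im z)\<^sup>2)"
    unfolding norm_exp_sq using assms by (simp add: algebra_simps flip: exp_add)
  also have "\<dots> \<le> exp (l * a\<^sup>2) * ((1 + 1 / l) / (1 + (Im z)\<^sup>2))"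
    using 1 by (intro mult_left_mono) auto
  finally show ?thesis by simp
qed

text \<open>
  The target is even, so the left side of the strip reflects onto the right one.
\<close>

lemma gaussian_cauchy_formula:
  fixes f :: "complex \<Rightarrow> complex"
  assumes l: "l > 0" and a: "a > 0" and z0: "Re z0 = 0"
  defines "f \<equiv> \<lambda>z. exp (of_real l * z\<^sup>2)"
  shows "(\<integral>y. f (Complex a y) * (1 / (Complex a y - z0) + 1 / (Complex a y + z0)) \<partial>lborel) = 2 * pi * f z0"
    and "integrable lborel (\<lambda>y. f (Complex a y) * (1 / (Complex a y - z0) + 1 / (Complex a y + z0)))"
proof -
  have hol: "f holomorphic_on A" for A unfolding f_def by (intro holomorphic_intros)
  have bd: "norm (f z) \<le> exp (l * a\<^sup>2) * (1 + 1 / l) / (1 + (Im z)\<^sup>2)" if "- a \<le> Re z" "Re z \<le> a" for z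
    unfolding f_def using gaussian_bound[OF l, of z a] that by auto
  have int: "integrable lborel (\<lambda>y. f (Complex a y) / (Complex a y - w))" if "Re w = 0" for w
    by (rule line_transform_integrable[OF _ holomorphic_on_imp_continuous_on[OF hol],
          where C = "exp (l * a\<^sup>2) * (1 + 1 / l)"]) (use that a bd in auto)
  have i1: "integrable lborel (\<lambda>y. f (Complex a y) / (Complex a y - z0))" using int z0 by simp
  have i2: "integrable lborel (\<lambda>y. f (Complex a y) / (Complex a y + z0))" using int[of "- z0"] z0 by simp
  have sum_eq: "f (Complex a y) * (1 / (Complex a y - z0) + 1 / (Complex a y + z0))
     = f (Complex a y) / (Complex a y - z0) + f (Complex a y) / (Complex a y + z0)" for y
    by (simp add: algebra_simps)
  show "integrable lborel (\<lambda>y. f (Complex a y) * (1 / (Complex a y - z0) + 1 / (Complex a y + z0)))"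
    unfolding sum_eq using i1 i2 by (rule Bochner_Integration.integrable_add)
  have "(\<integral>y. f (Complex a y) / (Complex a y - z0) \<partial>lborel)
      - (\<integral>y. f (Complex (- a) y) / (Complex (- a) y - z0) \<partial>lborel)
      = (if - a < Re z0 \<and> Re z0 < a then 2 * pi * f z0 else 0)"
    by (rule Cauchy_vertical_lines[of UNIV]) (use a z0 hol bd in auto)
  also have "(\<integral>y. f (Complex (- a) y) / (Complex (- a) y - z0) \<partial>lborel)
      = (\<integral>y. f (Complex (- a) (- y)) / (Complex (- a) (- y) - z0) \<partial>lborel)"
    by (rule lborel_integral_uminus[symmetric])
  also have "\<dots> = (\<integral>y. - (f (Complex a y) / (Complex a y + z0)) \<partial>lborel)"
  proof (rule Bochner_Integration.integral_cong)
    fix y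
    have c: "Complex (- a) (- y) = - Complex a y" by (simp add: complex_eq_iff)
    have "- Complex a y - z0 = - (Complex a y + z0)" by simp
    then show "f (Complex (- a) (- y)) / (Complex (- a) (- y) - z0) = - (f (Complex a y) / (Complex a y + z0))"
      unfolding c f_def by (simp only: power2_minus divide_minus_right)
  qed simp
  finally show "(\<integral>y. f (Complex a y) * (1 / (Complex a y - z0) + 1 / (Complex a y + z0)) \<partial>lborel) = 2 * pi * f z0"
    unfolding sum_eq using i1 i2 a z0 by simp
qed

text \<open>
  The Gaussian factor in the hypothesis pays for the non-uniformity of the geometric series: \<open>1 - \<bar>b(z)\<bar>\<close>
  decays only like \<open>1 / \<bar>z\<bar>\<^sup>2\<close> along the line.
\<close>

lemma truncated_chebyshev_approximation:
  fixes l a K :: real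
  assumes l: "l > 0" and a: "a > 0"
    and K: "\<And>z. Re z = a \<Longrightarrow> norm (exp (of_real l * z\<^sup>2)) * norm (cay z) ^ m \<le> K * exp (- (Im z)\<^sup>2)"
  obtains p :: "complex poly" where "degree p \<le> m"
    "\<And>x. x \<in> {-1..1} \<Longrightarrow> norm (of_real (F l x) - poly p (of_real x)) \<le> 2 * K * (2 + a) / a"
proof -
  define f where "f = (\<lambda>z. exp (of_real l * z\<^sup>2) :: complex)"
  obtain T :: "nat \<Rightarrow> complex poly" where T: "\<And>k. degree (T k) \<le> k"
      "\<And>k \<beta>. \<beta> \<noteq> 0 \<Longrightarrow> poly (T k) ((\<beta> + 1 / \<beta>) / 2) = \<beta> ^ k + 1 / \<beta> ^ k"
    using ex_chebyshev_poly by metis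
  define g where "g = (\<lambda>k y. f (Complex a y) * (cay (Complex a y) ^ k / (1 + Complex a y)))"
  define c where "c = (\<lambda>k. (\<integral>y. g k y \<partial>lborel) / (2 * pi))"
  define p where "p = (\<Sum>k<m. smult (c k) (T (Suc k) + T k))"
  have K0: "K \<ge> 0"
  proof -
    have "0 \<le> K * exp (- (Im (Complex a 0))\<^sup>2)"
      by (rule order_trans[OF _ K[of "Complex a 0"]]) auto
    then show ?thesis by simp
  qed
  have deg: "degree p \<le> m"
    unfolding p_def
  proof (intro degree_sum_le)
    fix k assume "k \<in> {..<m}"
    then show "degree (smult (c k) (T (Suc k) + T k)) \<le> m"
      using T(1)[of k] T(1)[of "Suc k"]
      by (intro order_trans[OF degree_smult_le] degree_add_le) auto
  qed simp
  have poly_p: "poly p ((\<beta> + 1 / \<beta>) / 2) = (\<Sum>k<m. c k * cheb_weight k \<beta>)" if "\<beta> \<noteq> 0" for \<beta>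
    unfolding p_def cheb_weight_def using T(2)[OF that] by (simp add: poly_sum)
  have nz: "1 + Complex a y \<noteq> 0" for y using a by (auto simp: complex_eq_iff)
  have contC: "continuous_on UNIV (Complex a)" by (rule continuous_on_Complex_Im)
  have gint: "integrable lborel (g k)" for k
  proof (rule integrable_by_inverse_square)
    show "continuous_on UNIV (g k)"
      unfolding g_def f_def cay_def using nz by (intro continuous_intros contC) auto
    fix y
    have "norm (1 + Complex a y) \<ge> 1" using abs_Re_le_cmod[of "1 + Complex a y"] a by simp
    then have "norm (cay (Complex a y) ^ k / (1 + Complex a y)) \<le> 1 / 1"
      unfolding norm_divide norm_power using norm_cay_le_1[of "Complex a y"] a
      by (intro frac_le power_le_one) auto
    then have "norm (g k y) \<le> norm (f (Complex a y)) * 1"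
      unfolding g_def norm_mult by (intro mult_left_mono) auto
    then show "norm (g k y) \<le> exp (l * a\<^sup>2) * (1 + 1 / l) / (1 + y\<^sup>2)"
      using gaussian_bound[OF l, of "Complex a y" a] a by (simp add: f_def)
  qed
  \<comment> \<open>in the variable \<open>z0\<close>, which parametrises \<open>-1 < x \<le> 1\<close> by \<open>z0\<^sup>2 = - (1 - x) / (1 + x)\<close>\<close>
  have main: "norm (f z0 - poly p ((cay z0 + 1 / cay z0) / 2)) \<le> 2 * K * (2 + a) / a"
    if z0: "Re z0 = 0" for z0
  proof -
    have "1 - z0 \<noteq> 0" "1 + z0 \<noteq> 0" using z0 by (auto simp: complex_eq_iff)
    then have \<beta>: "cay z0 \<noteq> 0" by (simp add: cay_def)
    define h where "h = (\<lambda>y. f (Complex a y) * (1 / (Complex a y - z0) + 1 / (Complex a y + z0)))"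
    define s where "s = (\<lambda>y. \<Sum>k<m. g k y * cheb_weight k (cay z0))"
    have hi: "integrable lborel h" "(\<integral>y. h y \<partial>lborel) = 2 * pi * f z0"
      unfolding h_def f_def using gaussian_cauchy_formula[OF l a z0] by auto
    have si: "integrable lborel s" "(\<integral>y. s y \<partial>lborel) = 2 * pi * (\<Sum>k<m. c k * cheb_weight k (cay z0))"
      unfolding s_def using gint by (auto simp: c_def sum_distrib_left)
    have eq: "(\<integral>y. h y - s y \<partial>lborel) = 2 * pi * (f z0 - poly p ((cay z0 + 1 / cay z0) / 2))"
      using hi si poly_p[OF \<beta>] by (simp add: algebra_simps)
    have nz': "Complex a y - z0 \<noteq> 0" "Complex a y + z0 \<noteq> 0" for y
      using a z0 by (auto simp: complex_eq_iff)
    have "norm (\<integral>y. h y - s y \<partial>lborel) \<le> (4 * K * (2 + a) / a) * pi"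
    proof (rule norm_integral_le_inverse_square)
      show "continuous_on UNIV (\<lambda>y. h y - s y)"
        unfolding h_def s_def g_def f_def cay_def using nz nz' by (intro continuous_intros contC) auto
      fix y
      define z where "z = Complex a y"
      have z: "Re z = a" "Im z = y" by (auto simp: z_def)
      have "h y - s y = f z * (1 / (z - z0) + 1 / (z + z0) - (\<Sum>k<m. cay z ^ k / (1 + z) * cheb_weight k (cay z0)))"
        unfolding h_def s_def g_def z_def by (simp add: right_diff_distrib sum_distrib_left mult.assoc)
      then have "norm (h y - s y) \<le> norm (f z) * (2 * norm (cay z) ^ m * norm (1 + z) / a)"
        using mult_left_mono[OF kernel_expansion[of z z0 m], of "norm (f z)"] z a z0
        by (simp only: norm_mult norm_ge_zero)
      also have "\<dots> = (norm (f z) * norm (cay z) ^ m) * (2 * norm (1 + z) / a)" by simp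
      also have "\<dots> \<le> (K * (2 / (1 + y\<^sup>2)\<^sup>2)) * (2 * ((2 + a) * (1 + y\<^sup>2)) / a)"
      proof (rule mult_mono)
        show "norm (f z) * norm (cay z) ^ m \<le> K * (2 / (1 + y\<^sup>2)\<^sup>2)"
          using K[of z] mult_left_mono[OF exp_neg_square_le[of y] K0] z by (simp add: f_def)
        have "norm (1 + z) \<le> \<bar>Re (1 + z)\<bar> + \<bar>Im (1 + z)\<bar>" by (rule cmod_le)
        also have "\<dots> \<le> 1 + a + (1 + y\<^sup>2)"
        proof -
          have "0 \<le> (\<bar>y\<bar> - 1)\<^sup>2" by simp
          then have "2 * \<bar>y\<bar> \<le> 1 + y\<^sup>2" by (simp add: power2_diff)
          then show ?thesis using a z by simp
        qed
        also have "\<dots> \<le> (2 + a) * (1 + y\<^sup>2)" using a by (simp add: algebra_simps)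
        finally show "2 * norm (1 + z) / a \<le> 2 * ((2 + a) * (1 + y\<^sup>2)) / a"
          using a by (intro divide_right_mono) auto
      qed (use K0 a in auto)
      also have "\<dots> = 4 * K * (2 + a) / a / (1 + y\<^sup>2)"
        using a by (simp add: power2_eq_square add_pos_nonneg less_imp_neq[symmetric] divide_simps)
      finally show "norm (h y - s y) \<le> 4 * K * (2 + a) / a / (1 + y\<^sup>2)" .
    qed
    moreover have "norm (2 * pi * e) = 2 * pi * norm e" for e :: complex by (simp add: norm_mult)
    ultimately have "2 * pi * norm (f z0 - poly p ((cay z0 + 1 / cay z0) / 2)) \<le> (4 * K * (2 + a) / a) * pi"
      unfolding eq by (simp only:)
    also have "\<dots> = 2 * pi * (2 * K * (2 + a) / a)" by simp
    finally have "2 * pi * norm (f z0 - poly p ((cay z0 + 1 / cay z0) / 2)) \<le> 2 * pi * (2 * K * (2 + a) / a)" .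
    then show ?thesis by (rule mult_left_le_imp_le) simp
  qed
  have "norm (of_real (F l x) - poly p (of_real x)) \<le> 2 * K * (2 + a) / a" if x: "x \<in> {-1..1}" for x
  proof (cases "x = -1")
    case True
    have "cheb_weight k (-1) = 0" for k
      by (simp add: cheb_weight_def)
    then have "poly p (-1) = 0" using poly_p[of "-1"] by simp
    then show ?thesis using True K0 a by (simp add: F_def)
  next
    case False
    then have x1: "x > -1" using x by simp
    define v where "v = sqrt ((1 - x) / (1 + x))"
    have v2: "v\<^sup>2 = (1 - x) / (1 + x)" using x x1 by (simp add: v_def)
    define z0 where "z0 = Complex 0 v"
    have z02: "z0\<^sup>2 = of_real (- ((1 - x) / (1 + x)))"
      unfolding v2[symmetric] by (simp add: z0_def complex_eq_iff power2_eq_square)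
    have nz: "1 + z0 \<noteq> 0" "1 - z0 \<noteq> 0" by (auto simp: z0_def complex_eq_iff)
    have "cay z0 + 1 / cay z0 = ((1 - z0)\<^sup>2 + (1 + z0)\<^sup>2) / ((1 + z0) * (1 - z0))"
      unfolding cay_def using nz by (simp add: add_frac_eq power2_eq_square)
    also have "\<dots> = 2 * ((1 + z0\<^sup>2) / (1 - z0\<^sup>2))"
      by (simp add: power2_eq_square algebra_simps)
    also have "(1 + z0\<^sup>2) / (1 - z0\<^sup>2) = of_real ((1 - (1 - x) / (1 + x)) / (1 + (1 - x) / (1 + x)))"
      unfolding z02 by simp
    also have "(1 - (1 - x) / (1 + x)) / (1 + (1 - x) / (1 + x)) = x"
      using x1 by (simp add: divide_simps)
    finally have "(cay z0 + 1 / cay z0) / 2 = of_real x" by simp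
    moreover have "f z0 = of_real (F l x)"
      unfolding f_def z02 using False by (simp add: F_def flip: exp_of_real)
    ultimately show ?thesis using main[of z0] by (simp add: z0_def)
  qed
  then show ?thesis using that deg by blast
qed

section \<open>The two approximation errors\<close>

lemma F_bounded:
  assumes "l \<ge> 0" "x \<in> {-1..1}"
  shows "0 \<le> F l x" "F l x \<le> 1"
  using assms by (auto simp: F_def divide_nonpos_pos intro!: divide_nonneg_nonneg mult_nonneg_nonneg)

lemma approx_error_ge:
  assumes "l \<ge> 0" "x \<in> {-1..1}"
  shows "norm (of_real (F l x) - poly p (of_real x)) \<le> approx_error l p"
  unfolding approx_error_def sup_norm_def
proof (rule cSUP_upper[OF assms(2)])
  have "compact ((\<lambda>x::real. poly p (of_real x)) ` {-1..1})"
    by (intro compact_continuous_image continuous_intros) auto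
  then have "bounded ((\<lambda>x::real. poly p (of_real x)) ` {-1..1})" by (rule compact_imp_bounded)
  then obtain B where B: "\<And>x::real. x \<in> {-1..1} \<Longrightarrow> norm (poly p (of_real x)) \<le> B"
    unfolding bounded_iff by blast
  show "bdd_above ((\<lambda>x. cmod (of_real (F l x) - poly p (of_real x))) ` {-1..1})"
  proof (rule bdd_aboveI2)
    fix x :: real assume x: "x \<in> {-1..1}"
    have "norm (complex_of_real (F l x)) \<le> 1" using F_bounded[OF assms(1) x] by simp
    then show "cmod (of_real (F l x) - poly p (of_real x)) \<le> 1 + B"
      using norm_triangle_ineq4[of "of_real (F l x)" "poly p (of_real x)"] B[OF x] by linarith
  qed
qed

lemma approx_error_le:
  assumes "\<And>x. x \<in> {-1..1} \<Longrightarrow> norm (of_real (F l x) - poly p (of_real x)) \<le> B"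
  shows "approx_error l p \<le> B"
  unfolding approx_error_def sup_norm_def by (rule cSUP_least) (use assms in auto)

lemma approx_error_nonneg:
  assumes "l \<ge> 0" shows "0 \<le> approx_error l p"
  by (rule order_trans[OF norm_ge_zero approx_error_ge[OF assms, of 0]]) simp

lemma cheb_error_le:
  assumes "l \<ge> 0" "degree p \<le> m"
  shows "cheb_error m l \<le> approx_error l p"
  unfolding cheb_error_def
  by (rule cINF_lower) (use assms approx_error_nonneg in \<open>auto intro!: bdd_belowI2\<close>)

lemma rational_error_bdd:
  fixes P :: "complex poly"
  assumes q: "q > 0" and t: "t \<ge> 0" and P: "degree P \<le> m"
  shows "bdd_above ((\<lambda>z::real. cmod (of_real (exp (t * z)) - poly P (of_real z) / (of_real q - of_real z) ^ m)) ` {..0})"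
proof (rule bdd_aboveI2)
  fix z :: real assume z: "z \<in> {..0}"
  define d where "d = q - z"
  have d: "d \<ge> q" "\<bar>z\<bar> \<le> d" "d > 0" using z q by (auto simp: d_def)
  have "norm (poly P (of_real z)) \<le> (\<Sum>k\<le>degree P. norm (coeff P k) * \<bar>z\<bar> ^ k)"
    unfolding poly_altdef by (rule order_trans[OF norm_sum]) (simp add: norm_mult norm_power)
  also have "\<dots> \<le> (\<Sum>k\<le>degree P. norm (coeff P k) / q ^ (m - k) * d ^ m)"
  proof (rule sum_mono)
    fix k assume "k \<in> {..degree P}"
    then have "d ^ m = d ^ k * d ^ (m - k)" using P by (simp flip: power_add)
    moreover have "\<bar>z\<bar> ^ k \<le> d ^ k" "q ^ (m - k) \<le> d ^ (m - k)" using d q by (auto intro!: power_mono)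
    ultimately have "\<bar>z\<bar> ^ k * q ^ (m - k) \<le> d ^ m" using q d by (simp add: mult_mono)
    then have "\<bar>z\<bar> ^ k \<le> d ^ m / q ^ (m - k)" using q by (simp add: pos_le_divide_eq)
    from mult_left_mono[OF this, of "norm (coeff P k)"]
    show "norm (coeff P k) * \<bar>z\<bar> ^ k \<le> norm (coeff P k) / q ^ (m - k) * d ^ m" by simp
  qed
  finally have "norm (poly P (of_real z)) / d ^ m \<le> (\<Sum>k\<le>degree P. norm (coeff P k) / q ^ (m - k))"
    using d unfolding sum_distrib_right[symmetric] by (simp add: pos_divide_le_eq)
  moreover have "norm (complex_of_real q - of_real z) = d"
    using d by (simp add: d_def flip: of_real_diff)
  then have "cmod (of_real (exp (t * z)) - poly P (of_real z) / (of_real q - of_real z) ^ m)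
      \<le> exp (t * z) + norm (poly P (of_real z)) / d ^ m"
    using norm_triangle_ineq4[of "of_real (exp (t * z))" "poly P (of_real z) / (of_real q - of_real z) ^ m"]
    by (simp add: norm_divide norm_power)
  moreover have "exp (t * z) \<le> 1"
    using z t by (simp add: mult_nonneg_nonpos)
  ultimately show "cmod (of_real (exp (t * z)) - poly P (of_real z) / (of_real q - of_real z) ^ m)
      \<le> 1 + (\<Sum>k\<le>degree P. norm (coeff P k) / q ^ (m - k))"
    by linarith
qed

lemma rat_error_ge:
  assumes "q > 0" "t \<ge> 0"
    and "\<And>(P :: complex poly) E. degree P \<le> m \<Longrightarrow>
      (\<And>z::real. z \<le> 0 \<Longrightarrow> cmod (of_real (exp (t * z)) - poly P (of_real z) / (of_real q - of_real z) ^ m) \<le> E) \<Longrightarrow> B \<le> E"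
  shows "B \<le> rat_error m t q"
  unfolding rat_error_def
proof (rule cINF_greatest)
  show "rat_class m q \<noteq> {}" unfolding rat_class_def by (auto intro: exI[of _ 0])
  fix r assume "r \<in> rat_class m q"
  then obtain P :: "complex poly" where P: "degree P \<le> m" "r = (\<lambda>z. poly P z / (of_real q - z) ^ m)"
    unfolding rat_class_def by auto
  show "B \<le> (SUP z\<in>{..0::real}. cmod (of_real (exp (t * z)) - r (of_real z)))"
    unfolding P(2) by (rule assms(3)[OF P(1)], rule cSUP_upper[OF _ rational_error_bdd]) (use assms P in auto)
qed

lemma rat_error_nonneg:
  assumes "q > 0" "t \<ge> 0"
  shows "0 \<le> rat_error m t q"
proof (rule rat_error_ge[OF assms])
  fix P :: "complex poly" and E
  assume "\<And>z::real. z \<le> 0 \<Longrightarrow> cmod (of_real (exp (t * z)) - poly P (of_real z) / (of_real q - of_real z) ^ m) \<le> E"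
  from order_trans[OF norm_ge_zero this[of 0]] show "0 \<le> E" by simp
qed

lemma rat_error_le:
  fixes P :: "complex poly"
  assumes "q > 0" "t \<ge> 0" "degree P \<le> m"
    and "\<And>z::real. z \<le> 0 \<Longrightarrow> cmod (of_real (exp (t * z)) - poly P (of_real z) / (of_real q - of_real z) ^ m) \<le> B"
  shows "rat_error m t q \<le> B"
proof -
  let ?r = "\<lambda>z. poly P z / (of_real q - z) ^ m"
  have "rat_error m t q \<le> (SUP z \<in> {..0::real}. cmod (of_real (exp (t * z)) - ?r (of_real z)))"
    unfolding rat_error_def
  proof (rule cINF_lower)
    show "?r \<in> rat_class m q" unfolding rat_class_def using assms(3) by blast
    show "bdd_below ((\<lambda>r. SUP z\<in>{..0::real}. cmod (of_real (exp (t * z)) - r (of_real z))) ` rat_class m q)"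
    proof (rule bdd_belowI2)
      fix r assume "r \<in> rat_class m q"
      then obtain P :: "complex poly" where P: "degree P \<le> m" "r = (\<lambda>z. poly P z / (of_real q - z) ^ m)"
        unfolding rat_class_def by auto
      show "0 \<le> (SUP z\<in>{..0::real}. cmod (of_real (exp (t * z)) - r (of_real z)))"
        unfolding P(2) by (rule cSUP_upper2[OF rational_error_bdd[OF assms(1,2) P(1)], of 0]) auto
    qed
  qed
  also have "\<dots> \<le> B" by (rule cSUP_least) (use assms in auto)
  finally show ?thesis .
qed


text \<open>
  Substituting \<open>x = (q + z) / (q - z)\<close> into a polynomial of degree at most \<open>m\<close> and clearing denominators
  gives a member of the rational class with the same error on \<open>z \<le> 0\<close>.
\<close>

lemma rat_error_le_cheb_error:
  assumes q: "q > 0" and t: "t \<ge> 0"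
  shows "rat_error m t q \<le> cheb_error m (t * q)"
  unfolding cheb_error_def
proof (rule cINF_greatest)
  show "{p :: complex poly. degree p \<le> m} \<noteq> {}" by (auto intro: exI[of _ 0])
  fix p :: "complex poly" assume "p \<in> {p. degree p \<le> m}"
  then have p: "degree p \<le> m" by simp
  define P where "P = (\<Sum>k\<le>m. smult (coeff p k) ([:of_real q, 1:] ^ k * [:of_real q, -1:] ^ (m - k)))"
  show "rat_error m t q \<le> approx_error (t * q) p"
  proof (rule rat_error_le[OF q t])
    show "degree P \<le> m"
      unfolding P_def
    proof (intro degree_sum_le)
      fix k assume "k \<in> {..m}"
      then have k: "k \<le> m" by simp
      have "degree ([:complex_of_real q, 1:] ^ k * [:of_real q, -1:] ^ (m - k))
          \<le> degree ([:complex_of_real q, 1:] ^ k) + degree ([:complex_of_real q, -1:] ^ (m - k))"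
        by (rule degree_mult_le)
      also have "\<dots> \<le> 1 * k + 1 * (m - k)"
        by (intro add_mono order_trans[OF degree_power_le]) auto
      finally show "degree (smult (coeff p k) ([:of_real q, 1:] ^ k * [:of_real q, -1:] ^ (m - k))) \<le> m"
        using k by (intro order_trans[OF degree_smult_le]) simp
    qed simp
  next
    fix z :: real assume z: "z \<le> 0"
    define x where "x = (q + z) / (q - z)"
    have d: "q - z > 0" using q z by simp
    have x: "x \<in> {-1..1}" using d z q by (simp add: x_def pos_divide_le_eq pos_le_divide_eq)
    have d': "complex_of_real q - of_real z \<noteq> 0" using d by (simp flip: of_real_diff)
    have "poly P (of_real z) / (of_real q - of_real z) ^ m
       = (\<Sum>k\<le>m. coeff p k * ((of_real q + of_real z) ^ k * ((of_real q - of_real z) ^ (m - k) / (of_real q - of_real z) ^ m)))"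
      unfolding P_def by (simp add: poly_sum sum_divide_distrib)
    also have "\<dots> = (\<Sum>k\<le>m. coeff p k * of_real x ^ k)"
    proof (intro sum.cong refl)
      fix k assume "k \<in> {..m}"
      then have "(complex_of_real q - of_real z) ^ m = (of_real q - of_real z) ^ k * (of_real q - of_real z) ^ (m - k)"
        by (simp flip: power_add)
      then have "(complex_of_real q - of_real z) ^ (m - k) / (of_real q - of_real z) ^ m = 1 / (of_real q - of_real z) ^ k"
        using d' by simp
      then show "coeff p k * ((of_real q + of_real z) ^ k * ((of_real q - of_real z) ^ (m - k) / (of_real q - of_real z) ^ m))
          = coeff p k * of_real x ^ k"
        by (simp add: x_def power_divide)
    qed
    also have "\<dots> = poly p (of_real x)"
      unfolding poly_altdef using p by (intro sum.mono_neutral_right) (auto simp: coeff_eq_0)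
    finally have r: "poly P (of_real z) / (of_real q - of_real z) ^ m = poly p (of_real x)" .
    have "x \<noteq> -1" using d q by (simp add: x_def divide_eq_eq)
    moreover have "(1 - x) / (1 + x) = - z / q"
    proof -
      have "1 - x = - 2 * z / (q - z)" "1 + x = 2 * q / (q - z)" using d by (simp_all add: x_def field_simps)
      then show ?thesis using d q by simp
    qed
    ultimately have "F (t * q) x = exp (t * z)" using q by (simp add: F_def)
    then show "cmod (of_real (exp (t * z)) - poly P (of_real z) / (of_real q - of_real z) ^ m) \<le> approx_error (t * q) p"
      unfolding r using approx_error_ge[of "t * q" x p] x q t by simp
  qed
qed

text \<open>
  The duality bound after the scaling \<open>z = q s\<close>, passed to the infimum over the class.
\<close>

lemma rat_error_duality:
  fixes t q n a x1 KA KB :: real and w :: complex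
  assumes q: "q > 0" and t: "t \<ge> 0" and n: "n \<ge> 0" and x: "0 < a" "a < Re w" "Re w < x1"
    and KA: "\<And>z. Re z = a \<Longrightarrow> norm (exp (of_real (t * q) * z\<^sup>2)) * norm (cay z) ^ m \<le> KA"
    and KB: "\<And>z. Re z = x1 \<Longrightarrow> norm (exp (of_real (t * q) * z\<^sup>2)) * norm (cay z) ^ m \<le> KB"
  shows "2 * (norm (exp (of_real (t * q) * w\<^sup>2)) * norm (cay w) ^ m / (norm (1 + w))\<^sup>2)
     \<le> rat_error m t q * (1 + exp (n * Re w)) / Re w
       + KA / (Re w - a) + KB * exp (- n * (x1 - Re w)) / (x1 - Re w)"
    (is "?L \<le> rat_error m t q * ?c / Re w + ?A + ?B")
proof -
  have c: "?c > 0" by (simp add: add_pos_pos)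
  have w: "Re w > 0" using x by simp
  have "(?L - ?A - ?B) * Re w / ?c \<le> rat_error m t q"
  proof (rule rat_error_ge[OF q t])
    fix P :: "complex poly" and E
    assume P: "degree P \<le> m"
      and E: "\<And>z::real. z \<le> 0 \<Longrightarrow> cmod (of_real (exp (t * z)) - poly P (of_real z) / (of_real q - of_real z) ^ m) \<le> E"
    define P' where "P' = smult (1 / of_real q ^ m) (pcompose P [:0, of_real q:])"
    have "degree P' \<le> m"
      unfolding P'_def using P degree_pcompose_le[of P "[:0, complex_of_real q:]"] q by simp
    moreover have "norm (of_real (exp (t * q * s)) - poly P' (of_real s) / (1 - of_real s) ^ m) \<le> E" if "s \<le> 0" for s :: real
    proof -
      have "complex_of_real q - of_real (q * s) = of_real q * (1 - of_real s)" by (simp add: algebra_simps)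
      then have "poly P (of_real (q * s)) / (of_real q - of_real (q * s)) ^ m = poly P' (of_real s) / (1 - of_real s) ^ m"
        unfolding P'_def by (simp add: poly_pcompose power_mult_distrib mult.commute)
      then show ?thesis using E[of "q * s"] that q by (simp add: mult_nonneg_nonpos mult.assoc)
    qed
    ultimately have "?L \<le> E * ?c / Re w + ?A + ?B"
      using t q by (intro rational_error_duality[of P' m "t * q" E n a w x1 KA KB]) (use n x KA KB in auto)
    then have "(?L - ?A - ?B) * Re w \<le> E * ?c" using w by (simp add: field_simps)
    then show "(?L - ?A - ?B) * Re w / ?c \<le> E" using c by (simp add: pos_divide_le_eq)
  qed
  then have "(?L - ?A - ?B) * Re w \<le> rat_error m t q * ?c" using c by (simp add: pos_divide_le_eq)
  then show ?thesis using w by (simp add: field_simps)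
qed

section \<open>Exponential rates\<close>

lemma eventually_const_le_exp:
  fixes m :: "nat \<Rightarrow> nat"
  assumes m: "filterlim m at_top sequentially" and \<delta>: "\<delta> > 0"
  shows "\<forall>\<^sub>F N in sequentially. C \<le> exp (real (m N) * \<delta>)"
proof -
  have "\<forall>\<^sub>F N in sequentially. C / \<delta> \<le> real (m N)"
    using filterlim_compose[OF filterlim_real_sequentially m] by (simp add: filterlim_at_top)
  then show ?thesis
  proof eventually_elim
    case (elim N)
    then have "C \<le> real (m N) * \<delta>" using \<delta> by (simp add: pos_divide_le_eq)
    also have "\<dots> \<le> exp (real (m N) * \<delta>)" using exp_ge_add_one_self[of "real (m N) * \<delta>"] by linarith
    finally show ?case .
  qed
qed

text \<open>
  Here \<open>lam N / m N\<close> only tends to \<open>\<alpha>\<close>, while \<open>line_bound\<close> needs \<open>\<alpha>\<close> itself and is to hold uniformly on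
  an unbounded line. Since \<open>log \<bar>b\<bar> \<le> 0\<close>, a share \<open>\<eta>\<close> of it may be dropped. The bound is applied with
  weight \<open>1 - \<eta>\<close>, and the rest of \<open>lam N\<close> is a positive multiple \<open>\<kappa> m N\<close> that also supplies the Gaussian
  factor.
\<close>

lemma line_bound_eventually:
  fixes lam :: "nat \<Rightarrow> real" and m :: "nat \<Rightarrow> nat"
  assumes \<alpha>: "\<alpha> > 0" and lim: "(\<lambda>N. lam N / real (m N)) \<longlonglongrightarrow> \<alpha>"
    and m: "filterlim m at_top sequentially" and x: "x > 0" and \<delta>: "\<delta> > 0"
  shows "\<forall>\<^sub>F N in sequentially. \<forall>z. Re z = x \<longrightarrow>
     norm (exp (of_real (lam N) * z\<^sup>2)) * norm (cay z) ^ m N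
       \<le> exp (real (m N) * (ridge \<alpha> x + \<delta>)) * exp (- (Im z)\<^sup>2)"
proof -
  define B where "B = \<bar>ridge \<alpha> x\<bar> + 2 * \<alpha> * x\<^sup>2"
  have B: "B > 0" using \<alpha> x by (simp add: B_def add_nonneg_pos)
  \<comment> \<open>small enough for the loss \<open>\<eta> \<bar>ridge \<alpha> x\<bar> + 2 \<eta> \<alpha> x\<^sup>2\<close> to stay below \<open>\<delta>\<close>\<close>
  define \<eta> where "\<eta> = min 1 (\<delta> / B)"
  have \<eta>: "\<eta> > 0" "\<eta> \<le> 1" "\<eta> * B \<le> \<delta>"
    using B \<delta> by (auto simp: \<eta>_def min_def field_simps)
  have e1: "\<forall>\<^sub>F N in sequentially. lam N / real (m N) > \<alpha> - \<eta> * \<alpha> / 2"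
    by (rule order_tendstoD(1)[OF lim]) (use \<eta> \<alpha> in simp)
  have e2: "\<forall>\<^sub>F N in sequentially. lam N / real (m N) < \<alpha> + \<eta> * \<alpha>"
    by (rule order_tendstoD(2)[OF lim]) (use \<eta> \<alpha> in simp)
  have e3: "\<forall>\<^sub>F N in sequentially. real (m N) \<ge> 1 + 2 / (\<eta> * \<alpha>)"
    using filterlim_compose[OF filterlim_real_sequentially m] by (simp add: filterlim_at_top)
  from e1 e2 e3 show ?thesis
  proof eventually_elim
    case (elim N)
    define M where "M = real (m N)"
    define \<kappa> where "\<kappa> = lam N / M - (1 - \<eta>) * \<alpha>"
    have M: "M \<ge> 1 + 2 / (\<eta> * \<alpha>)" using elim by (simp add: M_def)
    have M1: "M > 0" using M \<eta> \<alpha> by (smt (verit) divide_pos_pos mult_pos_pos)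
    have \<kappa>: "\<kappa> \<ge> \<eta> * \<alpha> / 2" "\<kappa> \<le> 2 * (\<eta> * \<alpha>)"
      using elim by (auto simp: \<kappa>_def M_def algebra_simps)
    have "1 \<le> (2 / (\<eta> * \<alpha>)) * (\<eta> * \<alpha> / 2)" using \<eta> \<alpha> by simp
    also have "\<dots> \<le> M * \<kappa>"
      using M \<kappa> \<eta> \<alpha> M1 by (intro mult_mono) auto
    finally have M\<kappa>: "1 \<le> M * \<kappa>" .
    have lamM: "lam N = M * ((1 - \<eta>) * \<alpha> + \<kappa>)" using M1 by (simp add: \<kappa>_def)
    show ?case
    proof (intro allI impI)
      fix z :: complex assume z: "Re z = x"
      define y where "y = Im z"
      show "norm (exp (of_real (lam N) * z\<^sup>2)) * norm (cay z) ^ m N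
         \<le> exp (real (m N) * (ridge \<alpha> x + \<delta>)) * exp (- (Im z)\<^sup>2)"
      proof (cases "cay z = 0")
        case True
        then have cay0: "norm (cay z) ^ m N = 0" using M1 by (simp add: M_def)
        show ?thesis unfolding cay0 by simp
      next
        case False
        define r where "r = ln (norm (cay z))"
        have r: "norm (cay z) = exp r" using False by (simp add: r_def)
        have r0: "r \<le> 0" using norm_cay_le_1[of z] z x by (simp add: r)
        have "exp (\<alpha> * (x\<^sup>2 - y\<^sup>2) + r) \<le> exp (ridge \<alpha> x)"
          using line_bound[OF \<alpha>, of z] z x unfolding norm_exp_sq r by (simp add: y_def exp_add)
        then have lb: "\<alpha> * (x\<^sup>2 - y\<^sup>2) + r \<le> ridge \<alpha> x" by simp
        have "(lam N / M) * (x\<^sup>2 - y\<^sup>2) + r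
            \<le> (1 - \<eta>) * (\<alpha> * (x\<^sup>2 - y\<^sup>2) + r) + \<kappa> * (x\<^sup>2 - y\<^sup>2)"
        proof -
          have e: "lam N / M = (1 - \<eta>) * \<alpha> + \<kappa>" by (simp add: \<kappa>_def)
          have "\<eta> * r \<le> 0" using \<eta> r0 by (simp add: mult_nonneg_nonpos)
          then show ?thesis unfolding e by (simp add: algebra_simps)
        qed
        also have "\<dots> \<le> (1 - \<eta>) * ridge \<alpha> x + \<kappa> * (x\<^sup>2 - y\<^sup>2)"
          using lb \<eta> by (intro add_right_mono mult_left_mono) auto
        also have "\<dots> \<le> ridge \<alpha> x + \<delta> - \<kappa> * y\<^sup>2"
        proof -
          have "\<kappa> * x\<^sup>2 \<le> 2 * (\<eta> * \<alpha>) * x\<^sup>2" using \<kappa> by (intro mult_right_mono) auto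
          moreover have "- \<eta> * ridge \<alpha> x \<le> \<eta> * \<bar>ridge \<alpha> x\<bar>"
            using mult_left_mono[of "- ridge \<alpha> x" "\<bar>ridge \<alpha> x\<bar>" \<eta>] \<eta> by simp
          ultimately show ?thesis using \<eta>(3) by (simp add: B_def algebra_simps)
        qed
        finally have "M * ((lam N / M) * (x\<^sup>2 - y\<^sup>2) + r) \<le> M * (ridge \<alpha> x + \<delta> - \<kappa> * y\<^sup>2)"
          using M1 by (intro mult_left_mono) auto
        also have "\<dots> \<le> M * (ridge \<alpha> x + \<delta>) - y\<^sup>2"
          using mult_right_mono[OF M\<kappa>, of "y\<^sup>2"] by (simp add: algebra_simps)
        finally have "exp (lam N * (x\<^sup>2 - y\<^sup>2) + M * r) \<le> exp (M * (ridge \<alpha> x + \<delta>) - y\<^sup>2)"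
          using M1 by (simp add: distrib_left)
        then show ?thesis
          unfolding norm_exp_sq r using z
          by (simp add: y_def M_def exp_add exp_diff exp_minus divide_inverse exp_of_nat_mult)
      qed
    qed
  qed
qed

lemma point_bound_eventually:
  fixes lam :: "nat \<Rightarrow> real" and m :: "nat \<Rightarrow> nat"
  assumes lim: "(\<lambda>N. lam N / real (m N)) \<longlonglongrightarrow> \<alpha>"
    and m: "filterlim m at_top sequentially" and \<delta>: "\<delta> > 0"
    and w: "norm (exp (of_real \<alpha> * w\<^sup>2)) * norm (cay w) = exp \<rho>"
  shows "\<forall>\<^sub>F N in sequentially.
     exp (real (m N) * (\<rho> - \<delta>)) \<le> norm (exp (of_real (lam N) * w\<^sup>2)) * norm (cay w) ^ m N"
proof -
  define X where "X = (Re w)\<^sup>2 - (Im w)\<^sup>2"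
  have "cay w \<noteq> 0" using w by auto
  define r where "r = ln (norm (cay w))"
  have r: "norm (cay w) = exp r" using \<open>cay w \<noteq> 0\<close> by (simp add: r_def)
  have \<rho>: "\<alpha> * X + r = \<rho>" using w unfolding norm_exp_sq r X_def by (simp flip: exp_add)
  have "(\<lambda>N. lam N / real (m N) * X + r) \<longlonglongrightarrow> \<alpha> * X + r" by (intro tendsto_intros lim)
  then have "\<forall>\<^sub>F N in sequentially. lam N / real (m N) * X + r > \<rho> - \<delta>"
    by (rule order_tendstoD) (use \<rho> \<delta> in simp)
  moreover have "\<forall>\<^sub>F N in sequentially. m N \<ge> 1" using m by (simp add: filterlim_at_top)
  ultimately show ?thesis
  proof eventually_elim
    case (elim N)
    have "real (m N) * (\<rho> - \<delta>) \<le> real (m N) * (lam N / real (m N) * X + r)"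
      using elim by (intro mult_left_mono) auto
    also have "\<dots> = lam N * X + real (m N) * r" using elim by (simp add: distrib_left)
    finally show ?case unfolding norm_exp_sq r X_def[symmetric]
      by (simp flip: exp_add exp_of_nat_mult)
  qed
qed

lemma cheb_error_upper:
  fixes lam :: "nat \<Rightarrow> real" and m :: "nat \<Rightarrow> nat"
  assumes \<alpha>: "\<alpha> > 0" and lim: "(\<lambda>N. lam N / real (m N)) \<longlonglongrightarrow> \<alpha>"
    and m: "filterlim m at_top sequentially" and a: "a > 0" and \<delta>: "\<delta> > 0"
  shows "\<forall>\<^sub>F N in sequentially. cheb_error (m N) (lam N) \<le> exp (real (m N) * (ridge \<alpha> a + \<delta>))"
proof -
  have e1: "\<forall>\<^sub>F N in sequentially. lam N / real (m N) > 0" by (rule order_tendstoD(1)[OF lim \<alpha>])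
  have d2: "\<delta> / 2 > 0" using \<delta> by simp
  from e1 line_bound_eventually[OF \<alpha> lim m a d2] eventually_const_le_exp[OF m d2, of "2 * (2 + a) / a"]
  show ?thesis
  proof eventually_elim
    case (elim N)
    have lam: "lam N > 0" using elim(1) by (auto simp: zero_less_divide_iff)
    define K where "K = exp (real (m N) * (ridge \<alpha> a + \<delta> / 2))"
    obtain p :: "complex poly" where p: "degree p \<le> m N"
       "\<And>x. x \<in> {-1..1} \<Longrightarrow> norm (of_real (F (lam N) x) - poly p (of_real x)) \<le> 2 * K * (2 + a) / a"
      using truncated_chebyshev_approximation[OF lam a, of "m N" K] elim(2) unfolding K_def by blast
    have "cheb_error (m N) (lam N) \<le> approx_error (lam N) p"
      using lam p(1) by (intro cheb_error_le) auto
    also have "\<dots> \<le> 2 * K * (2 + a) / a" by (rule approx_error_le[OF p(2)])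
    also have "\<dots> = (2 * (2 + a) / a) * K" by simp
    also have "\<dots> \<le> exp (real (m N) * (\<delta> / 2)) * K"
      using elim(3) by (intro mult_right_mono) (auto simp: K_def)
    also have "\<dots> = exp (real (m N) * (ridge \<alpha> a + \<delta>))"
      unfolding K_def exp_add[symmetric] by (simp add: algebra_simps)
    finally show ?case .
  qed
qed

text \<open>
  The tilt is \<open>n = \<epsilon> m\<close>. The residue then exceeds both line integrals by a factor \<open>exp (2 \<gamma> m)\<close>, and the norm
  of the test function costs at most \<open>exp (\<delta> m / 4)\<close>, both up to constants.
\<close>

lemma rat_error_lower:
  fixes q :: "nat \<Rightarrow> real" and m :: "nat \<Rightarrow> nat"
  assumes \<alpha>: "\<alpha> > 0" and lim: "(\<lambda>N. t * q N / real (m N)) \<longlonglongrightarrow> \<alpha>"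
    and m: "filterlim m at_top sequentially" and t: "t > 0"
    and a: "a > 0" "3 * a\<^sup>2 > 1" "8 * a ^ 3 - 2 * a = 1 / \<alpha>" and \<delta>: "\<delta> > 0"
  shows "\<forall>\<^sub>F N in sequentially. exp (real (m N) * (ridge \<alpha> a - \<delta>)) \<le> rat_error (m N) t (q N)"
proof -
  define \<epsilon> where "\<epsilon> = (\<delta> / 4) / (a + 1)"
  have \<epsilon>: "\<epsilon> > 0" "\<epsilon> * (a + 1) = \<delta> / 4"
    using a(1) \<delta> nonzero_eq_divide_eq[of "a + 1" \<epsilon> "\<delta> / 4"] \<epsilon>_def by simp_all
  obtain x0 x1 where x: "a < x0" "x0 < x1" "x0 < a + 1" "height \<alpha> x0 \<ge> 1 + x0\<^sup>2"
      and rx: "ridge \<alpha> a < ridge \<alpha> x0" "ridge \<alpha> x1 - ridge \<alpha> x0 < \<epsilon> * (x1 - x0)"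
    using ridge_rises_slowly[OF \<alpha> a \<epsilon>(1)] by blast
  define w where "w = Complex x0 (sqrt (height \<alpha> x0 - 1 - x0\<^sup>2))"
  have w: "Re w = x0" by (simp add: w_def)
  have wv: "norm (exp (of_real \<alpha> * w\<^sup>2)) * norm (cay w) = exp (ridge \<alpha> x0)"
    unfolding w_def using line_bound_attained[OF \<alpha> _ x(4)] a x by simp
  define \<gamma> where "\<gamma> = min \<delta> (min (ridge \<alpha> x0 - ridge \<alpha> a) (\<epsilon> * (x1 - x0) - (ridge \<alpha> x1 - ridge \<alpha> x0))) / 4"
  have \<gamma>4: "4 * \<gamma> \<le> \<delta>" "4 * \<gamma> \<le> ridge \<alpha> x0 - ridge \<alpha> a"
      "4 * \<gamma> \<le> \<epsilon> * (x1 - x0) - (ridge \<alpha> x1 - ridge \<alpha> x0)"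
    by (simp_all add: \<gamma>_def)
  have \<gamma>0: "\<gamma> > 0" using \<delta> rx by (simp add: \<gamma>_def)
  have \<gamma>: "\<gamma> > 0" "4 * \<gamma> \<le> \<delta>" "ridge \<alpha> a + \<gamma> \<le> ridge \<alpha> x0 - 3 * \<gamma>"
      "ridge \<alpha> x1 + \<gamma> - \<epsilon> * (x1 - x0) \<le> ridge \<alpha> x0 - 3 * \<gamma>"
    using \<gamma>4 \<gamma>0 by linarith+
  define D where "D = (norm (1 + w))\<^sup>2"
  have D: "D > 0" using w x a by (auto simp: D_def complex_eq_iff)
  define c where "c = 1 / (x0 - a) + 1 / (x1 - x0)"
  have e1: "\<forall>\<^sub>F N in sequentially. t * q N / real (m N) > 0" by (rule order_tendstoD(1)[OF lim \<alpha>])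
  have x1: "x1 > 0" using a x by simp
  from e1 line_bound_eventually[OF \<alpha> lim m a(1) \<gamma>(1)] line_bound_eventually[OF \<alpha> lim m x1 \<gamma>(1)]
    point_bound_eventually[OF lim m \<gamma>(1) wv] eventually_const_le_exp[OF m \<gamma>(1), of "c * D"]
    eventually_const_le_exp[OF m \<gamma>(1), of "2 * D / x0"]
  show ?thesis
  proof eventually_elim
    case (elim N)
    define M where "M = real (m N)"
    have M0: "M \<ge> 0" by (simp add: M_def)
    have q: "q N > 0" using elim(1) t by (auto simp: zero_less_divide_iff zero_less_mult_iff)
    define KA where "KA = exp (M * (ridge \<alpha> a + \<gamma>))"
    define KB where "KB = exp (M * (ridge \<alpha> x1 + \<gamma>))"
    define V where "V = norm (exp (of_real (t * q N) * w\<^sup>2)) * norm (cay w) ^ m N"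
    define E where "E = rat_error (m N) t (q N)"
    have E0: "E \<ge> 0" unfolding E_def using rat_error_nonneg[OF q] t by simp
    have KA: "norm (exp (of_real (t * q N) * z\<^sup>2)) * norm (cay z) ^ m N \<le> KA" if "Re z = a" for z
    proof (rule order_trans)
      show "norm (exp (of_real (t * q N) * z\<^sup>2)) * norm (cay z) ^ m N \<le> KA * exp (- (Im z)\<^sup>2)"
        using elim(2) that unfolding KA_def M_def by blast
      show "KA * exp (- (Im z)\<^sup>2) \<le> KA" by (rule mult_left_le) (simp_all add: KA_def)
    qed
    have KB: "norm (exp (of_real (t * q N) * z\<^sup>2)) * norm (cay z) ^ m N \<le> KB" if "Re z = x1" for z
    proof (rule order_trans)
      show "norm (exp (of_real (t * q N) * z\<^sup>2)) * norm (cay z) ^ m N \<le> KB * exp (- (Im z)\<^sup>2)"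
        using elim(3) that unfolding KB_def M_def by blast
      show "KB * exp (- (Im z)\<^sup>2) \<le> KB" by (rule mult_left_le) (simp_all add: KB_def)
    qed
    have "2 * (V / D) \<le> E * (1 + exp (\<epsilon> * M * Re w)) / Re w + KA / (Re w - a)
        + KB * exp (- (\<epsilon> * M) * (x1 - Re w)) / (x1 - Re w)"
      unfolding V_def D_def E_def
      by (rule rat_error_duality[OF q]) (use t w x a \<epsilon> M0 KA KB in auto)
    then have main: "2 * (V / D) \<le> E * (1 + exp (\<epsilon> * M * x0)) / x0 + KA / (x0 - a)
        + KB * exp (- (\<epsilon> * M) * (x1 - x0)) / (x1 - x0)" unfolding w .
    define G where "G = exp (M * (ridge \<alpha> x0 - 3 * \<gamma>))"
    have "KA \<le> G" unfolding KA_def G_def using \<gamma>(3) M0 by (simp add: mult_left_mono)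
    then have tA: "KA / (x0 - a) \<le> 1 / (x0 - a) * G" using x by (simp add: divide_right_mono)
    have "KB * exp (- (\<epsilon> * M) * (x1 - x0)) = exp (M * (ridge \<alpha> x1 + \<gamma> - \<epsilon> * (x1 - x0)))"
      unfolding KB_def exp_add[symmetric] by (simp add: algebra_simps)
    also have "\<dots> \<le> G" unfolding G_def using \<gamma>(4) M0 by (simp add: mult_left_mono)
    finally have tB: "KB * exp (- (\<epsilon> * M) * (x1 - x0)) / (x1 - x0) \<le> 1 / (x1 - x0) * G"
      using x by (simp add: divide_right_mono)
    have V: "exp (M * (ridge \<alpha> x0 - \<gamma>)) \<le> V" using elim(4) by (simp add: V_def M_def)
    have "(c * D) * G \<le> exp (M * \<gamma>) * G"
      using elim(5) by (intro mult_right_mono) (auto simp: M_def G_def)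
    also have "\<dots> \<le> exp (M * (ridge \<alpha> x0 - \<gamma>))"
      unfolding G_def exp_add[symmetric] using \<gamma>(1) M0 by (simp add: algebra_simps)
    also note V
    finally have "c * G \<le> V / D" using D by (simp add: pos_le_divide_eq mult_ac)
    then have "KA / (x0 - a) + KB * exp (- (\<epsilon> * M) * (x1 - x0)) / (x1 - x0) \<le> V / D"
      using tA tB by (simp add: c_def distrib_right)
    with main have "V / D \<le> E * (1 + exp (\<epsilon> * M * x0)) / x0" by linarith
    then have "V * x0 / D \<le> E * (1 + exp (\<epsilon> * M * x0))" using x a D by (simp add: field_simps)
    also have "\<dots> \<le> E * (2 * exp (M * (\<delta> / 4)))"
    proof (rule mult_left_mono)
      have "\<epsilon> * M * x0 \<le> M * (\<delta> / 4)"
        unfolding \<epsilon>(2)[symmetric] using x \<epsilon>(1) M0 by (simp add: mult_ac mult_left_mono)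
      then have "exp (\<epsilon> * M * x0) \<le> exp (M * (\<delta> / 4))" by simp
      moreover have "1 \<le> exp (M * (\<delta> / 4))" using M0 \<delta> by simp
      ultimately show "1 + exp (\<epsilon> * M * x0) \<le> 2 * exp (M * (\<delta> / 4))" by linarith
      show "E \<ge> 0" by (rule E0)
    qed
    finally have 1: "V \<le> E * exp (M * (\<delta> / 4)) * (2 * D / x0)"
      using x a D by (simp add: field_simps)
    note V
    also note 1
    also have "E * exp (M * (\<delta> / 4)) * (2 * D / x0) \<le> E * exp (M * (\<delta> / 4)) * exp (M * \<gamma>)"
      using elim(6) E0 by (intro mult_left_mono) (auto simp: M_def)
    also have "\<dots> = E * exp (M * (\<delta> / 4 + \<gamma>))" by (simp add: exp_add distrib_left)
    finally have "exp (M * (ridge \<alpha> x0 - \<gamma>)) * exp (- (M * (\<delta> / 4 + \<gamma>)))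
        \<le> E * exp (M * (\<delta> / 4 + \<gamma>)) * exp (- (M * (\<delta> / 4 + \<gamma>)))"
      by (rule mult_right_mono) simp
    then have "exp (M * (ridge \<alpha> x0 - 2 * \<gamma> - \<delta> / 4)) \<le> E"
      unfolding mult.assoc exp_add[symmetric] by (simp add: algebra_simps)
    moreover have "M * (ridge \<alpha> a - \<delta>) \<le> M * (ridge \<alpha> x0 - 2 * \<gamma> - \<delta> / 4)"
      using \<gamma> \<delta> rx M0 by (intro mult_left_mono) auto
    then have "exp (M * (ridge \<alpha> a - \<delta>)) \<le> exp (M * (ridge \<alpha> x0 - 2 * \<gamma> - \<delta> / 4))" by simp
    ultimately show ?case unfolding E_def M_def by linarith
  qed
qed

lemma root_limit:
  fixes X :: "nat \<Rightarrow> real" and m :: "nat \<Rightarrow> nat"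
  assumes m: "filterlim m at_top sequentially"
    and lo: "\<And>\<delta>. \<delta> > 0 \<Longrightarrow> \<forall>\<^sub>F N in sequentially. exp (real (m N) * (L - \<delta>)) \<le> X N"
    and up: "\<And>\<delta>. \<delta> > 0 \<Longrightarrow> \<forall>\<^sub>F N in sequentially. X N \<le> exp (real (m N) * (L + \<delta>))"
  shows "(\<lambda>N. X N powr (1 / real (m N))) \<longlonglongrightarrow> exp L"
proof -
  have m1: "\<forall>\<^sub>F N in sequentially. m N \<ge> 1" using m by (simp add: filterlim_at_top)
  have lim: "(\<lambda>N. ln (X N) / real (m N)) \<longlonglongrightarrow> L"
  proof (rule tendstoI)
    fix e :: real assume e: "e > 0"
    then have e2: "e / 2 > 0" by simp
    from lo[OF e2] up[OF e2] m1
    show "\<forall>\<^sub>F N in sequentially. dist (ln (X N) / real (m N)) L < e"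
    proof eventually_elim
      case (elim N)
      have X: "X N > 0" using elim(1) by (meson exp_gt_zero less_le_trans)
      have "real (m N) * (L - e / 2) \<le> ln (X N)" "ln (X N) \<le> real (m N) * (L + e / 2)"
        using elim(1,2) X ln_ge_iff[OF X] ln_le_cancel_iff[OF X, of "exp (real (m N) * (L + e / 2))"]
        by (simp_all only: exp_gt_zero ln_exp)
      then have "L - e / 2 \<le> ln (X N) / real (m N)" "ln (X N) / real (m N) \<le> L + e / 2"
        using elim(3) by (simp_all add: pos_le_divide_eq pos_divide_le_eq mult.commute)
      then have "\<bar>ln (X N) / real (m N) - L\<bar> \<le> e / 2" by (simp only: abs_le_iff) linarith
      then show ?case using e by (simp add: dist_real_def)
    qed
  qed
  have ev: "\<forall>\<^sub>F N in sequentially. exp (ln (X N) / real (m N)) = X N powr (1 / real (m N))"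
    using lo[of 1, simplified]
  proof eventually_elim
    case (elim N)
    have "X N > 0" using elim by (meson exp_gt_zero less_le_trans)
    then show ?case by (simp add: powr_def)
  qed
  show ?thesis
    by (rule Lim_transform_eventually[OF tendsto_exp[OF lim] ev])
qed

theorem theorem6p4:
  fixes t \<alpha>hat \<theta> :: real and q :: "nat \<Rightarrow> real" and m :: "nat \<Rightarrow> nat"
  assumes "t > 0" and "\<alpha>hat > 0"
    and "\<And>N. N \<ge> 1 \<Longrightarrow> q N = \<alpha>hat * real N / t"
    and "\<And>N. N \<ge> 1 \<Longrightarrow> m N > 0"
    and "(\<lambda>N. real (m N) / real N) \<longlonglongrightarrow> \<theta>" and "\<theta> > 0"
    and "0 < \<alpha>hat / \<theta>" and "\<alpha>hat / \<theta> < alpha_c"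
  shows "(\<lambda>N. rat_error (m N) t (q N) powr (1 / real (m N))) \<longlonglongrightarrow> H_e (\<alpha>hat / \<theta>) \<and>
    (\<forall>(p :: nat \<Rightarrow> complex poly) (C :: nat \<Rightarrow> real).
       (\<forall>N\<ge>1. degree (p N) \<le> m N
          \<and> cheb_error (m N) (t * q N) \<le> approx_error (t * q N) (p N)
          \<and> approx_error (t * q N) (p N) \<le> C N * cheb_error (m N) (t * q N)
          \<and> C N \<ge> 1)
       \<and> (\<lambda>N. ln (C N)) \<in> o(\<lambda>N. real (m N))
       \<longrightarrow> (\<lambda>N. approx_error (t * q N) (p N) powr (1 / real (m N)))
             \<longlonglongrightarrow> H_e (\<alpha>hat / \<theta>))"
proof -
  define \<alpha> where "\<alpha> = \<alpha>hat / \<theta>"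
  have \<alpha>: "\<alpha> > 0" "\<alpha> < alpha_c" using assms by (auto simp: \<alpha>_def)
  obtain a where a: "a > 0" "3 * a\<^sup>2 > 1" "8 * a ^ 3 - 2 * a = 1 / \<alpha>"
    using critical_abscissa[OF \<alpha>] .
  define L where "L = ridge \<alpha> a"
  have H: "H_e \<alpha> = exp L" unfolding L_def by (rule H_e_eq_ridge[OF \<alpha>(1) a])
  have N1: "\<forall>\<^sub>F N :: nat in sequentially. N \<ge> 1" by (rule eventually_ge_at_top)
  have "filterlim (\<lambda>N. (real (m N) / real N) * real N) at_top sequentially"
    by (rule filterlim_tendsto_pos_mult_at_top[OF assms(5,6) filterlim_real_sequentially])
  moreover have "\<forall>\<^sub>F N in sequentially. (real (m N) / real N) * real N = real (m N)"
    using N1 by eventually_elim simp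
  ultimately have rm: "filterlim (\<lambda>N. real (m N)) at_top sequentially"
    by (rule filterlim_mono_eventually[OF _ order_refl order_refl])
  have m: "filterlim m at_top sequentially"
    using rm unfolding filterlim_at_top
    by (metis (mono_tags, lifting) eventually_mono of_nat_le_iff)
  have "(\<lambda>N. \<alpha>hat / (real (m N) / real N)) \<longlonglongrightarrow> \<alpha>hat / \<theta>"
    by (intro tendsto_intros assms(5)) (use assms in simp)
  moreover have "\<forall>\<^sub>F N in sequentially. \<alpha>hat / (real (m N) / real N) = t * q N / real (m N)"
    using N1 by eventually_elim (use assms in simp)
  ultimately have lim: "(\<lambda>N. t * q N / real (m N)) \<longlonglongrightarrow> \<alpha>"
    unfolding \<alpha>_def by (rule Lim_transform_eventually)
  have q: "q N > 0" if "N \<ge> 1" for N using assms that by simp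
  have rc: "\<forall>\<^sub>F N in sequentially. rat_error (m N) t (q N) \<le> cheb_error (m N) (t * q N)"
    using N1 by eventually_elim (rule rat_error_le_cheb_error[OF q less_imp_le[OF assms(1)]])
  have lo: "\<forall>\<^sub>F N in sequentially. exp (real (m N) * (L - \<delta>)) \<le> rat_error (m N) t (q N)" if "\<delta> > 0" for \<delta>
    unfolding L_def by (rule rat_error_lower[OF \<alpha>(1) lim m assms(1) a that])
  have up: "\<forall>\<^sub>F N in sequentially. cheb_error (m N) (t * q N) \<le> exp (real (m N) * (L + \<delta>))" if "\<delta> > 0" for \<delta>
    unfolding L_def by (rule cheb_error_upper[OF \<alpha>(1) lim m a(1) that])
  have "(\<lambda>N. rat_error (m N) t (q N) powr (1 / real (m N))) \<longlonglongrightarrow> exp L"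
  proof (rule root_limit[OF m lo])
    fix \<delta> :: real assume "\<delta> > 0"
    from rc up[OF this] show "\<forall>\<^sub>F N in sequentially. rat_error (m N) t (q N) \<le> exp (real (m N) * (L + \<delta>))"
      by eventually_elim simp
  qed
  moreover have "(\<lambda>N. approx_error (t * q N) (p N) powr (1 / real (m N))) \<longlonglongrightarrow> exp L"
    if p: "\<forall>N\<ge>1. degree (p N) \<le> m N
          \<and> cheb_error (m N) (t * q N) \<le> approx_error (t * q N) (p N)
          \<and> approx_error (t * q N) (p N) \<le> C N * cheb_error (m N) (t * q N)
          \<and> C N \<ge> 1" and C: "(\<lambda>N. ln (C N)) \<in> o(\<lambda>N. real (m N))"
    for p :: "nat \<Rightarrow> complex poly" and C :: "nat \<Rightarrow> real"
  proof (rule root_limit[OF m])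
    fix \<delta> :: real assume \<delta>: "\<delta> > 0"
    from N1 rc lo[OF \<delta>] show "\<forall>\<^sub>F N in sequentially. exp (real (m N) * (L - \<delta>)) \<le> approx_error (t * q N) (p N)"
    proof eventually_elim
      case (elim N)
      have "cheb_error (m N) (t * q N) \<le> approx_error (t * q N) (p N)" using p elim(1) by blast
      with elim show ?case by linarith
    qed
    have \<delta>2: "\<delta> / 2 > 0" using \<delta> by simp
    from N1 up[OF \<delta>2] landau_o.smallD[OF C \<delta>2]
    show "\<forall>\<^sub>F N in sequentially. approx_error (t * q N) (p N) \<le> exp (real (m N) * (L + \<delta>))"
    proof eventually_elim
      case (elim N)
      have C1: "C N \<ge> 1" and le: "approx_error (t * q N) (p N) \<le> C N * cheb_error (m N) (t * q N)"
        using p elim(1) by blast+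
      have "ln (C N) \<le> real (m N) * (\<delta> / 2)" using elim(3) by (simp add: mult.commute)
      then have CN: "C N \<le> exp (real (m N) * (\<delta> / 2))" using C1 ln_le_cancel_iff[of "C N" "exp (real (m N) * (\<delta> / 2))"] by simp
      note le
      also have "C N * cheb_error (m N) (t * q N) \<le> C N * exp (real (m N) * (L + \<delta> / 2))"
        using elim(2) C1 by (intro mult_left_mono) auto
      also have "\<dots> \<le> exp (real (m N) * (\<delta> / 2)) * exp (real (m N) * (L + \<delta> / 2))"
        using CN by (intro mult_right_mono) auto
      also have "\<dots> = exp (real (m N) * (L + \<delta>))"
        unfolding exp_add[symmetric] by (simp add: algebra_simps)
      finally show ?case .
    qed
  qed
  ultimately show ?thesis unfolding \<alpha>_def[symmetric] H by blast
qed

end
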